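(* Let $G$ be a finite, directed, strongly connected multigraph with vertex set $\{1,\ldots,m\}$, adjacency matrix $D=(d_{ij})$ and out-degrees $d_i=\sum_j d_{ij}$. For $i\in G$ and $h\ge1$ let $\widetilde{\mathcal T}^h_i$ be the wired directed cover of $G$ of height $h$ with root $r$ of type $i$, and let $R^h_i$ be the order of the root element $\hat r_h=e_r$ in the rotor-router group $\mathsf{RR}(\widetilde{\mathcal T}^h_i)$. Starting from a recurrent rotor configuration, route $R^h_i$ particles successively from $r$, each until it hits the sink; let $S^h_{i,\downarrow}$ be the number of these particles stopped in $s_\downarrow$ and $S^h_{i,\uparrow}$ the number stopped in $s^\uparrow$. Then for all $i\in G$ and $h\ge 1$ $$R^h_i=S^h_{i,\downarrow}+S^h_{i,\uparrow},$$ and these numbers can be computed recursively: for all $i\in G$, $S^1_{i,\downarrow}=1$ and $S^1_{i,\uparrow}=d_i$, and for all $h\ge2$ $$S^h_{i,\downarrow}=\operatorname{lcm}\big(\{R^{h-1}_{\chi_i(k)}: k=1,\ldots,d_i\}\big),\qquad S^h_{i,\uparrow}=S^h_{i,\downarrow}\sum_{j\in G}d_{ij}\,\frac{S^{h-1}_{j,\uparrow}}{R^{h-1}_j},$$ where $\chi_i(k)\in G$ is the type of the $k$-th child of a vertex of type $i$ and $\operatorname{lcm}$ denotes the least common multiple.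
   Context: Directed cover: $d_{ij}$ is the number of directed edges from $i$ to $j$ in $G$. The directed cover $\mathcal T_i$ of $G$ is the rooted tree with vertices labelled (typed) by vertices of $G$, whose root $r$ has type $i$ and in which every vertex of type $k$ has exactly $d_{kj}$ children of type $j$, for each $j\in G$. An additional vertex $r^{(0)}$ (the ancestor of the root) is attached to $r$ by one edge. The tree is planted plane: each vertex $x$ of type $i$ has its neighbours listed in a fixed order $(x^{(0)},x^{(1)},\ldots,x^{(d_i)})$, where $x^{(0)}$ is the ancestor and $x^{(k)}$, $1\le k\le d_i$, is the $k$-th child, whose type is $\chi_i(k)$; here $\chi_i:\{1,\ldots,d_i\}\to G$ is a fixed function (the generation function) taking each value $j$ exactly $d_{ij}$ times. Truncated and wired trees: $|x|$ is the graph distance from $r$ to $x$. For $h\ge1$, $\mathcal T^h_i$ is the subtree induced by the vertices with $|x|\le h$, together with $r^{(0)}$ and the edge $\{r,r^{(0)}\}$. The down and up sinks are the vertex sets $s_\downarrow=\{r^{(0)}\}$ and $s^\uparrow=\{x:|x|=h\}$, and $S=s_\downarrow\cup s^\uparrow$. The wired tree $\widetilde{\mathcal T}^h_i$ is the multigraph obtained from $\mathcal T^h_i$ by contracting $S$ to a single vertex $s$, the sink, keeping multiple edges. A particle reaching the sink is said to stop in $s_\downarrow$ or in $s^\uparrow$ according to whether the last edge it used is the one joining $r$ to $r^{(0)}$ or an edge leading to a vertex at height $h$ of $\mathcal T^h_i$. Rotor-router group: a rotor configuration $\rho$ assigns to each non-sink vertex $x$ of the wired tree one of its incident edges (the rotor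 at $x$). At each step of a rotor-router walk, the particle at $x$ first advances the rotor at $x$ to the next edge in the fixed cyclic order of the edges at $x$ (given by the order of neighbours above) and then moves along the edge the rotor now points to. For a rotor configuration $\rho$, $e_x(\rho)$ is the rotor configuration obtained by starting a particle at $x$ and running the rotor-router walk until it reaches the sink $s$ (which always happens). A configuration is recurrent if the rotors, viewed as directed edges pointing away from their vertices, form no directed cycle, i.e. they form an oriented spanning tree rooted at $s$. Each $e_x$ permutes the set of recurrent configurations, and the rotor-router group $\mathsf{RR}$ is the (abelian) subgroup of the group of permutations of the set of recurrent configurations generated by all $e_x$ with $x$ a non-sink vertex. *)

theory Defs
  imports
    "Graph_Theory.Digraph_Component"
    "HOL-Algebra.Bij"
    "HOL-Algebra.Generated_Groups"
    "HOL-Algebra.Multiplicative_Group"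
    Complex_Main
begin

section \<open>Rotor-router walks on a graph with a sink\<close>

text \<open>
  A loopless undirected multigraph with one sink and an ordering of the edges at every other
  vertex. The vertices are \<open>Some v\<close> for \<open>v \<in> inner g\<close>, and \<open>None\<close>, the sink. The edges at
  \<open>v \<in> inner g\<close> are numbered \<open>0, \<dots>, deg g v - 1\<close> in their cyclic order; number \<open>k\<close> leads to
  \<open>nbr g v k\<close>. Different numbers are different edges, even if they lead to the same vertex.
  A rotor at \<open>v\<close> is given by the number at \<open>v\<close> of the edge it points to.
\<close>

record 'v sink_graph =
  inner :: "'v set"
  deg :: "'v \<Rightarrow> nat"
  nbr :: "'v \<Rightarrow> nat \<Rightarrow> 'v option"

definition rotor_configs :: "'v sink_graph \<Rightarrow> ('v \<Rightarrow> nat) set" where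
  "rotor_configs g = (\<Pi>\<^sub>E v\<in>inner g. {..<deg g v})"

definition recurrent_configs :: "'v sink_graph \<Rightarrow> ('v \<Rightarrow> nat) set" where
  "recurrent_configs g =
     {\<rho> \<in> rotor_configs g. acyclic {(Some v, nbr g v (\<rho> v)) | v. v \<in> inner g}}"

fun rotor_step ::
    "'v sink_graph \<Rightarrow> ('v \<Rightarrow> nat) \<times> 'v option \<Rightarrow> ('v \<Rightarrow> nat) \<times> 'v option" where
  "rotor_step g (\<rho>, None) = (\<rho>, None)"
| "rotor_step g (\<rho>, Some v) =
     (let k = Suc (\<rho> v) mod deg g v in (\<rho>(v := k), nbr g v k))"

definition rotor_walk ::
    "'v sink_graph \<Rightarrow> 'v \<Rightarrow> ('v \<Rightarrow> nat) \<Rightarrow> nat \<Rightarrow> ('v \<Rightarrow> nat) \<times> 'v option" where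
  "rotor_walk g v \<rho> n = (rotor_step g ^^ n) (\<rho>, Some v)"

definition hitting_time :: "'v sink_graph \<Rightarrow> 'v \<Rightarrow> ('v \<Rightarrow> nat) \<Rightarrow> nat" where
  "hitting_time g v \<rho> = (LEAST n. snd (rotor_walk g v \<rho> n) = None)"

definition route :: "'v sink_graph \<Rightarrow> 'v \<Rightarrow> ('v \<Rightarrow> nat) \<Rightarrow> ('v \<Rightarrow> nat)" where
  "route g v \<rho> = fst (rotor_walk g v \<rho> (hitting_time g v \<rho>))"

text \<open>
  The last edge used by the particle, as a pair of its non-sink end and its number there: after
  the last step, the rotor at the vertex just left points along the edge just used.
\<close>

definition last_edge :: "'v sink_graph \<Rightarrow> 'v \<Rightarrow> ('v \<Rightarrow> nat) \<Rightarrow> 'v \<times> nat" where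
  "last_edge g v \<rho> =
     (let w = the (snd (rotor_walk g v \<rho> (hitting_time g v \<rho> - 1))) in (w, route g v \<rho> w))"

definition rr_element :: "'v sink_graph \<Rightarrow> 'v \<Rightarrow> ('v \<Rightarrow> nat) \<Rightarrow> ('v \<Rightarrow> nat)" where
  "rr_element g v = restrict (route g v) (recurrent_configs g)"

definition rotor_router_group :: "'v sink_graph \<Rightarrow> (('v \<Rightarrow> nat) \<Rightarrow> ('v \<Rightarrow> nat)) monoid" where
  "rotor_router_group g =
     (let B = BijGroup (recurrent_configs g)
      in B\<lparr>carrier := generate B (rr_element g ` inner g)\<rparr>)"

section \<open>Directed covers\<close>

definition adj :: "('a, 'e) pre_digraph \<Rightarrow> 'a \<Rightarrow> 'a \<Rightarrow> nat" where
  "adj G i j = card {e \<in> arcs G. tail G e = i \<and> head G e = j}"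

definition outdeg :: "('a, 'e) pre_digraph \<Rightarrow> 'a \<Rightarrow> nat" where
  "outdeg G i = (\<Sum>j\<in>verts G. adj G i j)"

definition generation_function :: "('a, 'e) pre_digraph \<Rightarrow> ('a \<Rightarrow> nat \<Rightarrow> 'a) \<Rightarrow> bool" where
  "generation_function G \<chi> \<longleftrightarrow>
     (\<forall>i\<in>verts G. \<chi> i ` {1..outdeg G i} \<subseteq> verts G \<and>
        (\<forall>j\<in>verts G. card {k \<in> {1..outdeg G i}. \<chi> i k = j} = adj G i j))"

text \<open>
  A vertex of the cover is addressed by the list of child numbers on the path from the root to
  it, so the root is \<open>Node []\<close>, the \<open>k\<close>-th child of \<open>Node x\<close> is \<open>Node (x @ [k])\<close>, and \<open>Node x\<close>
  has distance \<open>length x\<close> from the root. \<open>Anc\<close> is the ancestor of the root.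
\<close>

datatype cover_vertex = Anc | Node "nat list"

definition vertex_type :: "('a \<Rightarrow> nat \<Rightarrow> 'a) \<Rightarrow> 'a \<Rightarrow> nat list \<Rightarrow> 'a" where
  "vertex_type \<chi> i x = foldl \<chi> i x"

inductive_set cover_addresses ::
    "('a, 'e) pre_digraph \<Rightarrow> ('a \<Rightarrow> nat \<Rightarrow> 'a) \<Rightarrow> 'a \<Rightarrow> nat list set"
  for G :: "('a, 'e) pre_digraph" and \<chi> :: "'a \<Rightarrow> nat \<Rightarrow> 'a" and i :: 'a where
  root: "[] \<in> cover_addresses G \<chi> i"
| child: "x \<in> cover_addresses G \<chi> i \<Longrightarrow> k \<in> {1..outdeg G (vertex_type \<chi> i x)}
    \<Longrightarrow> x @ [k] \<in> cover_addresses G \<chi> i"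

fun cover_deg :: "('a, 'e) pre_digraph \<Rightarrow> ('a \<Rightarrow> nat \<Rightarrow> 'a) \<Rightarrow> 'a \<Rightarrow> cover_vertex \<Rightarrow> nat" where
  "cover_deg G \<chi> i Anc = 1"
| "cover_deg G \<chi> i (Node x) = Suc (outdeg G (vertex_type \<chi> i x))"

fun cover_nbr :: "cover_vertex \<Rightarrow> nat \<Rightarrow> cover_vertex" where
  "cover_nbr Anc k = Node []"
| "cover_nbr (Node x) 0 = (if x = [] then Anc else Node (butlast x))"
| "cover_nbr (Node x) (Suc k) = Node (x @ [Suc k])"

definition truncated_cover ::
    "('a, 'e) pre_digraph \<Rightarrow> ('a \<Rightarrow> nat \<Rightarrow> 'a) \<Rightarrow> nat \<Rightarrow> 'a \<Rightarrow> cover_vertex set" where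
  "truncated_cover G \<chi> h i = {Anc} \<union> Node ` {x \<in> cover_addresses G \<chi> i. length x \<le> h}"

definition sink_down :: "cover_vertex set" where
  "sink_down = {Anc}"

definition sink_up ::
    "('a, 'e) pre_digraph \<Rightarrow> ('a \<Rightarrow> nat \<Rightarrow> 'a) \<Rightarrow> nat \<Rightarrow> 'a \<Rightarrow> cover_vertex set" where
  "sink_up G \<chi> h i = Node ` {x \<in> cover_addresses G \<chi> i. length x = h}"

definition contract :: "'v set \<Rightarrow> 'v \<Rightarrow> 'v option" where
  "contract S v = (if v \<in> S then None else Some v)"

text \<open>
  For \<open>h \<ge> 1\<close>, all neighbours in the cover of a non-sink vertex lie in the truncated cover, so
  truncating and contracting leave the numbered edges at such a vertex unchanged; and no edge of
  the truncated cover joins two vertices of the sink set.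
\<close>

definition wired_cover ::
    "('a, 'e) pre_digraph \<Rightarrow> ('a \<Rightarrow> nat \<Rightarrow> 'a) \<Rightarrow> nat \<Rightarrow> 'a \<Rightarrow> cover_vertex sink_graph" where
  "wired_cover G \<chi> h i =
     (let S = sink_down \<union> sink_up G \<chi> h i
      in \<lparr>inner = truncated_cover G \<chi> h i - S,
          deg = cover_deg G \<chi> i,
          nbr = (\<lambda>v k. contract S (cover_nbr v k))\<rparr>)"

definition root_order :: "('a, 'e) pre_digraph \<Rightarrow> ('a \<Rightarrow> nat \<Rightarrow> 'a) \<Rightarrow> nat \<Rightarrow> 'a \<Rightarrow> nat" where
  "root_order G \<chi> h i =
     (let g = wired_cover G \<chi> h i
      in group.ord (rotor_router_group g) (rr_element g (Node [])))"

text \<open>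
  The number of particles stopped in a part \<open>A\<close> of the sink set, when \<open>root_order G \<chi> h i\<close>
  particles are routed one after the other from the root, starting with rotors \<open>\<rho>\<close>.
\<close>

definition stopped_in ::
    "cover_vertex set \<Rightarrow> ('a, 'e) pre_digraph \<Rightarrow> ('a \<Rightarrow> nat \<Rightarrow> 'a) \<Rightarrow> nat \<Rightarrow> 'a
       \<Rightarrow> (cover_vertex \<Rightarrow> nat) \<Rightarrow> nat" where
  "stopped_in A G \<chi> h i \<rho> =
     (let g = wired_cover G \<chi> h i; r = Node []
      in card {n. n < root_order G \<chi> h i \<and>
           (case last_edge g r ((route g r ^^ n) \<rho>) of (v, k) \<Rightarrow> cover_nbr v k \<in> A)})"

definition stopped_down ::
    "('a, 'e) pre_digraph \<Rightarrow> ('a \<Rightarrow> nat \<Rightarrow> 'a) \<Rightarrow> nat \<Rightarrow> 'a \<Rightarrow> (cover_vertex \<Rightarrow> nat) \<Rightarrow> nat" where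
  "stopped_down G \<chi> h i = stopped_in sink_down G \<chi> h i"

definition stopped_up ::
    "('a, 'e) pre_digraph \<Rightarrow> ('a \<Rightarrow> nat \<Rightarrow> 'a) \<Rightarrow> nat \<Rightarrow> 'a \<Rightarrow> (cover_vertex \<Rightarrow> nat) \<Rightarrow> nat" where
  "stopped_up G \<chi> h i = stopped_in (sink_up G \<chi> h i) G \<chi> h i"

end

theory Submission
  imports Defs
begin

text \<open>
Write \<open>E\<close> for the action of \<open>e\<^sub>r\<close> on the recurrent configurations of the wired cover
of height \<open>h + 1\<close> with root type \<open>i\<close>, \<open>d\<close> for the out-degree of \<open>i\<close>, and \<open>E\<^sub>k\<close> for the action
of the root element of the \<open>k\<close>-th branch, which is itself a wired cover, of height \<open>h\<close> and root
type \<open>\<chi>\<^sub>i(k)\<close>, whose ancestor is the root \<open>r\<close>.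

While a particle is inside a branch, only that branch matters. So the walk can be watched only when
the particle is at \<open>r\<close> or stopped: in one turn, the rotor at \<open>r\<close> advances to some \<open>k\<close>, and if
\<open>k \<noteq> 0\<close>, then branch \<open>k\<close> is changed by \<open>E\<^sub>k\<close>. If a stopped particle is at once replaced by a new
one at \<open>r\<close>, then these turns are the iteration of one map \<open>M\<close> on configurations (\<open>root_turn\<close>), an
odometer: \<open>d + 1\<close> turns send one particle along each edge at \<open>r\<close> and apply each \<open>E\<^sub>k\<close> once. Hence, if
each \<open>E\<^sub>k\<close> has exact period \<open>R\<^sub>k\<close> at every recurrent configuration, then \<open>M\<close> has exact period
\<open>L (d + 1)\<close> with \<open>L = lcm R\<^sub>k\<close> at every recurrent configuration (\<open>root_turn_period\<close>).

After a turn, the particle has stopped exactly if the rotor at \<open>r\<close> points down, or it points to a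
child \<open>k\<close> whose own rotor does not point back to \<open>r\<close>. This is a property of the configuration alone,
and all recurrent configurations have it, as otherwise the rotors at \<open>r\<close> and its child would form a
cycle. So \<open>E\<close> is the map that \<open>M\<close> induces by first return to the stopping configurations. Its
exact period is the number of stopping configurations in one period of \<open>M\<close>
(\<open>induced_map_period\<close>). Of these, \<open>L\<close> are due to particles stopped down, one for every full rotation
of the rotor at \<open>r\<close>; and branch \<open>k\<close>, which is entered \<open>L\<close> times, goes \<open>L / R\<^sub>k\<close> times through its
own period and contributes \<open>L / R\<^sub>k\<close> times its number of particles stopped up
(\<open>root_cycle_Suc\<close>). Summing over the children by type gives the recursion.

The period of \<open>E\<close> is thus the same at all recurrent configurations, and is therefore the order of
\<open>e\<^sub>r\<close>. That all \<open>e\<^sub>x\<close> are permutations of the recurrent configurations, so that they do generate a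
group, holds for every finite graph with a sink. Give the sink one edge, to \<open>x\<close>. Then the walk
continues after reaching the sink, and its states become unicycles: all rotors lead to the particle.
The walk is injective on this finite set, and \<open>e\<^sub>x\<close> is its first return map to the sink.
\<close>

section \<open>Iterated maps\<close>

lemma funpow_in: "f ` A \<subseteq> A \<Longrightarrow> x \<in> A \<Longrightarrow> (f ^^ n) x \<in> A"
  by (induction n) auto

lemma funpow_split: "m \<le> n \<Longrightarrow> (f ^^ n) x = (f ^^ (n - m)) ((f ^^ m) x)"
  using funpow_add[of "n - m" m f] by simp

lemma inj_on_funpow:
  assumes "f ` A \<subseteq> A" "inj_on f A"
  shows "inj_on (f ^^ n) A"
proof (induction n)
  case (Suc n)
  have "inj_on (f \<circ> f ^^ n) A"
    using Suc funpow_in[OF assms(1)]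
    by (intro comp_inj_on) (auto intro: inj_on_subset[OF assms(2)])
  then show ?case by (simp add: comp_def)
qed simp

lemma funpow_recurs:
  assumes "finite A" "f ` A \<subseteq> A" "inj_on f A" "x \<in> A"
  obtains n where "n > 0" "(f ^^ n) x = x"
proof -
  have "\<not> inj (\<lambda>n. (f ^^ n) x)"
  proof
    assume "inj (\<lambda>n. (f ^^ n) x)"
    moreover have "finite (range (\<lambda>n. (f ^^ n) x))"
      using funpow_in[OF assms(2,4)] by (intro finite_subset[OF _ assms(1)]) auto
    ultimately show False using finite_imageD by fastforce
  qed
  then obtain a b where "a < b" and eq: "(f ^^ a) x = (f ^^ b) x"
    unfolding inj_def by (metis linorder_neqE_nat)
  then have "(f ^^ a) x = (f ^^ a) ((f ^^ (b - a)) x)"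
    using funpow_split[of "b - a" b f x] by simp
  then have "(f ^^ (b - a)) x = x"
    using inj_on_funpow[OF assms(2,3), of a] assms(4) funpow_in[OF assms(2,4)]
    by (metis inj_onD)
  then show thesis using that[of "b - a"] \<open>a < b\<close> by simp
qed

text \<open>
The path from \<open>u\<close> up to its first visit to \<open>p\<close> does not use the value at \<open>p\<close>.
\<close>

lemma reach_redirect:
  assumes "(f ^^ n) u = p" and "\<And>v. v \<noteq> p \<Longrightarrow> f' v = f v"
  shows "\<exists>n. (f' ^^ n) u = p"
  using assms(1)
proof (induction n arbitrary: u)
  case 0
  then show ?case by (metis funpow_0)
next
  case (Suc n)
  show ?case
  proof (cases "u = p")
    case True
    then show ?thesis by (metis funpow_0)
  next
    case False
    from Suc obtain m where "(f' ^^ m) (f u) = p"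
      by (metis funpow_Suc_right o_apply)
    then have "(f' ^^ Suc m) u = p"
      using assms(2)[OF False] by (simp del: funpow.simps add: funpow_Suc_right)
    then show ?thesis by blast
  qed
qed

text \<open>
Both \<open>p\<close> and \<open>q\<close> lie on the cycle of \<open>w\<close>, and a map is injective on each of its cycles. If \<open>p\<close> is
reached first, the orbit of \<open>w\<close> has closed up there, so it can reach \<open>q\<close> only if it has done so
before.
\<close>

lemma cycle_predecessor_unique:
  assumes "f p = w" "f q = w" "(f ^^ m) w = p" "(f ^^ n) w = q"
  shows "p = q"
proof -
  have le: False
    if "f p = w" and a: "a = (LEAST n. (f ^^ n) w = p)" "(f ^^ a) w = p"
      and b: "b = (LEAST n. (f ^^ n) w = q)" "(f ^^ b) w = q" and "a < b" for p q a b
  proof -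
    have "(f ^^ Suc a) w = w" using that by simp
    then have "(f ^^ (b mod Suc a)) w = q"
      using b(2) funpow_mod_eq by metis
    then have "b \<le> b mod Suc a" unfolding b(1) by (rule Least_le)
    then show False using \<open>a < b\<close> mod_less_divisor[of "Suc a" b] by linarith
  qed
  define a b where "a = (LEAST n. (f ^^ n) w = p)" and "b = (LEAST n. (f ^^ n) w = q)"
  have "(f ^^ a) w = p" "(f ^^ b) w = q"
    unfolding a_def b_def using assms(3,4) by (auto intro: LeastI)
  then show ?thesis
    using le[OF assms(1) a_def _ b_def] le[OF assms(2) b_def _ a_def]
    by (metis linorder_neqE_nat)
qed

section \<open>Rotor-router walks permute the recurrent configurations\<close>

locale finite_sink_graph =
  fixes g :: "'v sink_graph"
  assumes finite_inner: "finite (inner g)"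
    and nbr_closed: "v \<in> inner g \<Longrightarrow> k < deg g v \<Longrightarrow> nbr g v k \<in> insert None (Some ` inner g)"
begin

definition vertices :: "'v option set" where
  "vertices = insert None (Some ` inner g)"

lemma in_vertices [simp]: "None \<in> vertices" "Some v \<in> vertices \<longleftrightarrow> v \<in> inner g"
  by (auto simp: vertices_def)

lemma nbr_in_vertices: "v \<in> inner g \<Longrightarrow> k < deg g v \<Longrightarrow> nbr g v k \<in> vertices"
  using nbr_closed by (simp add: vertices_def)

text \<open>
The functional graph of the rotors, with the sink given a single edge, to the starting vertex \<open>x\<close> of
the particles.
\<close>

fun rotor_target :: "'v \<Rightarrow> ('v \<Rightarrow> nat) \<Rightarrow> 'v option \<Rightarrow> 'v option" where
  "rotor_target x \<rho> None = Some x"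
| "rotor_target x \<rho> (Some v) = nbr g v (\<rho> v)"

text \<open>
States from which every vertex is led by the rotors to the particle at \<open>p\<close>. As the vertex set is
finite, this says that the rotors, with the edge from the sink to \<open>x\<close>, have exactly one cycle and that
the particle is on it.
\<close>

definition unicycles :: "'v \<Rightarrow> (('v \<Rightarrow> nat) \<times> 'v option) set" where
  "unicycles x = {(\<rho>, p). \<rho> \<in> rotor_configs g \<and> p \<in> vertices \<and>
     (\<forall>u \<in> vertices. \<exists>n. (rotor_target x \<rho> ^^ n) u = p)}"

fun reentrant_step :: "'v \<Rightarrow> ('v \<Rightarrow> nat) \<times> 'v option \<Rightarrow> ('v \<Rightarrow> nat) \<times> 'v option" where
  "reentrant_step x (\<rho>, None) = (\<rho>, Some x)"
| "reentrant_step x (\<rho>, Some v) = rotor_step g (\<rho>, Some v)"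

lemma finite_rotor_configs: "finite (rotor_configs g)"
  unfolding rotor_configs_def using finite_inner by (intro finite_PiE) auto

lemma finite_recurrent_configs: "finite (recurrent_configs g)"
  unfolding recurrent_configs_def using finite_rotor_configs by simp

lemma finite_unicycles: "finite (unicycles x)"
proof -
  have "unicycles x \<subseteq> rotor_configs g \<times> vertices"
    by (auto simp: unicycles_def)
  moreover have "finite vertices"
    using finite_inner by (simp add: vertices_def)
  ultimately show ?thesis
    using finite_rotor_configs finite_subset by blast
qed

lemma unicyclesD:
  assumes "(\<rho>, p) \<in> unicycles x"
  shows "\<rho> \<in> rotor_configs g" "p \<in> vertices"
    "u \<in> vertices \<Longrightarrow> \<exists>n. (rotor_target x \<rho> ^^ n) u = p"
  using assms by (simp_all add: unicycles_def)

lemma rotor_configs_upd: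
  "\<rho> \<in> rotor_configs g \<Longrightarrow> v \<in> inner g \<Longrightarrow> k < deg g v \<Longrightarrow> \<rho>(v := k) \<in> rotor_configs g"
  unfolding rotor_configs_def by (auto simp: PiE_iff extensional_def)

lemma rotor_configs_less: "\<rho> \<in> rotor_configs g \<Longrightarrow> v \<in> inner g \<Longrightarrow> \<rho> v < deg g v"
  unfolding rotor_configs_def by auto

text \<open>
Following acyclic rotors on finitely many vertices ends at the only vertex without a rotor, the sink.
Conversely, the number of steps to the sink decreases along rotors and so forbids cycles.
\<close>

lemma recurrent_iff_unicycle:
  "\<rho> \<in> recurrent_configs g \<longleftrightarrow> (\<rho>, None) \<in> unicycles x"
proof (cases "\<rho> \<in> rotor_configs g")
  case config: True
  define r where "r = {(Some v, nbr g v (\<rho> v)) | v. v \<in> inner g}"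
  let ?f = "rotor_target x \<rho>"
  have "acyclic r \<longleftrightarrow> (\<forall>u \<in> vertices. \<exists>n. (?f ^^ n) u = None)"
  proof
    assume "acyclic r"
    have "finite r" unfolding r_def using finite_inner by simp
    with \<open>acyclic r\<close> have "wf (r\<inverse>)" by (rule finite_acyclic_wf_converse[rotated])
    have "u \<in> vertices \<longrightarrow> (\<exists>n. (?f ^^ n) u = None)" for u
      using \<open>wf (r\<inverse>)\<close>
    proof (induction u)
      case (less u)
      show ?case
      proof (cases u)
        case None
        then show ?thesis by (metis funpow_0)
      next
        case (Some v)
        show ?thesis
        proof
          assume "u \<in> vertices"
          then have v: "v \<in> inner g" using Some by auto
          then have "(?f u, u) \<in> r\<inverse>" unfolding r_def Some by auto
          moreover have "?f u \<in> vertices"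
            using nbr_in_vertices[OF v rotor_configs_less[OF config v]] Some by simp
          ultimately obtain n where "(?f ^^ n) (?f u) = None" using less by blast
          then have "(?f ^^ Suc n) u = None" by (simp del: funpow.simps add: funpow_Suc_right)
          then show "\<exists>n. (?f ^^ n) u = None" by blast
        qed
      qed
    qed
    then show "\<forall>u \<in> vertices. \<exists>n. (?f ^^ n) u = None" by blast
  next
    assume reach: "\<forall>u \<in> vertices. \<exists>n. (?f ^^ n) u = None"
    define rank where "rank u = (LEAST n. (?f ^^ n) u = None)" for u
    have "r \<subseteq> (measure rank)\<inverse>"
    proof (clarsimp simp: r_def)
      fix v assume v: "v \<in> inner g"
      have "(?f ^^ rank (Some v)) (Some v) = None"
        unfolding rank_def by (rule LeastI_ex) (use reach v in auto)
      moreover from this obtain m where m: "rank (Some v) = Suc m"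
        by (cases "rank (Some v)") auto
      ultimately have "(?f ^^ m) (nbr g v (\<rho> v)) = None"
        by (simp del: funpow.simps add: funpow_Suc_right)
      then have "rank (nbr g v (\<rho> v)) \<le> m" unfolding rank_def by (rule Least_le)
      then show "rank (nbr g v (\<rho> v)) < rank (Some v)" using m by simp
    qed
    moreover have "acyclic ((measure rank)\<inverse>)"
      by (simp add: wf_acyclic)
    ultimately show "acyclic r" by (rule acyclic_subset[rotated])
  qed
  then show ?thesis
    using config unfolding recurrent_configs_def unicycles_def r_def by auto
qed (simp add: recurrent_configs_def unicycles_def)

lemma rotor_step_inner:
  assumes "\<rho> \<in> rotor_configs g" "v \<in> inner g"
  defines "k \<equiv> Suc (\<rho> v) mod deg g v"
  shows "rotor_step g (\<rho>, Some v) = (\<rho>(v := k), nbr g v k)" "\<rho>(v := k) \<in> rotor_configs g"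
    "nbr g v k \<in> vertices"
proof -
  have "k < deg g v"
    using rotor_configs_less[OF assms(1,2)] unfolding k_def by (intro mod_less_divisor) simp
  then show "\<rho>(v := k) \<in> rotor_configs g" "nbr g v k \<in> vertices"
    using rotor_configs_upd[OF assms(1,2)] nbr_in_vertices[OF assms(2)] by auto
qed (simp add: k_def Let_def)

text \<open>
Advancing the rotor at the particle changes only the edge at the particle, so all vertices still
reach the old position, and from there the new rotor leads to the new position.
\<close>

lemma reentrant_step_unicycles:
  assumes "x \<in> inner g"
  shows "reentrant_step x ` unicycles x \<subseteq> unicycles x"
proof clarify
  fix \<sigma> q \<rho> p assume U: "(\<rho>, p) \<in> unicycles x" and s: "(\<sigma>, q) = reentrant_step x (\<rho>, p)"
  have \<rho>: "\<rho> \<in> rotor_configs g" and p: "p \<in> vertices" using unicyclesD[OF U] by auto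
  have *: "\<sigma> \<in> rotor_configs g \<and> q \<in> vertices \<and> rotor_target x \<sigma> p = q
     \<and> (\<forall>u. u \<noteq> p \<longrightarrow> rotor_target x \<sigma> u = rotor_target x \<rho> u)"
  proof (cases p)
    case None
    then show ?thesis using s \<rho> assms by auto
  next
    case (Some v)
    then have "v \<in> inner g" using p by auto
    from rotor_step_inner[OF \<rho> this] have
      "\<sigma> = \<rho>(v := Suc (\<rho> v) mod deg g v)" "q = nbr g v (Suc (\<rho> v) mod deg g v)"
      "\<sigma> \<in> rotor_configs g" "q \<in> vertices"
      using s Some by auto
    moreover have "rotor_target x \<sigma> u = rotor_target x \<rho> u" if "u \<noteq> p" for u
      using that Some \<open>\<sigma> = _\<close> by (cases u) auto
    ultimately show ?thesis using Some by auto
  qed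
  have "\<exists>n. (rotor_target x \<sigma> ^^ n) u = q" if u: "u \<in> vertices" for u
  proof -
    obtain n where "(rotor_target x \<rho> ^^ n) u = p" using unicyclesD(3)[OF U u] by blast
    then obtain n where "(rotor_target x \<sigma> ^^ n) u = p"
      using reach_redirect[of n "rotor_target x \<rho>" u p "rotor_target x \<sigma>"] * by blast
    then have "(rotor_target x \<sigma> ^^ Suc n) u = q" using * by simp
    then show ?thesis by blast
  qed
  then show "(\<sigma>, q) \<in> unicycles x" using * by (simp add: unicycles_def)
qed

text \<open>
After a step, the vertex just left lies on the cycle of the new state, immediately before the
particle. This makes the step reversible.
\<close>

lemma reentrant_step_vertex:
  assumes "(\<rho>, p) \<in> unicycles x" "reentrant_step x (\<rho>, p) = (\<sigma>, w)" "x \<in> inner g"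
  shows "rotor_target x \<sigma> p = w" "\<exists>n. (rotor_target x \<sigma> ^^ n) w = p"
    "w \<in> vertices"
proof -
  have \<rho>: "\<rho> \<in> rotor_configs g" and p: "p \<in> vertices" using unicyclesD[OF assms(1)] by auto
  have *: "rotor_target x \<sigma> p = w \<and> (\<forall>u. u \<noteq> p \<longrightarrow> rotor_target x \<sigma> u = rotor_target x \<rho> u)"
  proof (cases p)
    case (Some v)
    have "rotor_target x \<sigma> u = rotor_target x \<rho> u" if "u \<noteq> p" for u
      using that Some assms(2) by (cases u) (auto simp: Let_def)
    then show ?thesis using assms(2) Some by (auto simp: Let_def)
  qed (use assms in auto)
  then show "rotor_target x \<sigma> p = w" by simp
  show w: "w \<in> vertices"
  proof -
    have "(\<sigma>, w) \<in> unicycles x"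
      using reentrant_step_unicycles[OF assms(3)] assms(1,2) by (metis image_subset_iff)
    then show ?thesis by (simp add: unicycles_def)
  qed
  then obtain n where "(rotor_target x \<rho> ^^ n) w = p" using unicyclesD(3)[OF assms(1)] by blast
  then show "\<exists>n. (rotor_target x \<sigma> ^^ n) w = p"
    using reach_redirect[of n "rotor_target x \<rho>" w p "rotor_target x \<sigma>"] * by blast
qed

text \<open>
The vertex just left is determined as the predecessor of the particle on the cycle; turning its rotor
back by one edge recovers the previous state.
\<close>

lemma inj_on_reentrant_step:
  assumes "x \<in> inner g"
  shows "inj_on (reentrant_step x) (unicycles x)"
proof (rule inj_onI, clarify)
  fix \<rho> p \<tau> q
  assume U: "(\<rho>, p) \<in> unicycles x" "(\<tau>, q) \<in> unicycles x"
    and "reentrant_step x (\<rho>, p) = reentrant_step x (\<tau>, q)"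
  then obtain \<sigma> w where s: "reentrant_step x (\<rho>, p) = (\<sigma>, w)" "reentrant_step x (\<tau>, q) = (\<sigma>, w)"
    by (metis surj_pair)
  have "p = q"
  proof -
    note v = reentrant_step_vertex[OF U(1) s(1) assms] reentrant_step_vertex[OF U(2) s(2) assms]
    then obtain m n where
      "(rotor_target x \<sigma> ^^ m) w = p" "(rotor_target x \<sigma> ^^ n) w = q" by blast
    then show ?thesis using cycle_predecessor_unique v(1,4) by metis
  qed
  moreover have "\<rho> = \<tau>"
  proof (cases p)
    case None
    then show ?thesis using s \<open>p = q\<close> by simp
  next
    case (Some v)
    have less: "\<rho> v < deg g v" "\<tau> v < deg g v"
      using U Some rotor_configs_less \<open>p = q\<close> by (auto simp: unicycles_def)
    have eq: "\<rho>(v := Suc (\<rho> v) mod deg g v) = \<tau>(v := Suc (\<tau> v) mod deg g v)"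
      using s Some \<open>p = q\<close> by (auto simp: Let_def)
    then have "Suc (\<rho> v) mod deg g v = Suc (\<tau> v) mod deg g v" by (metis fun_upd_same)
    then have "\<rho> v = \<tau> v" using less by (simp add: mod_Suc split: if_splits)
    then show ?thesis using eq by (metis fun_upd_triv fun_upd_upd)
  qed
  ultimately show "\<rho> = \<tau> \<and> p = q" by simp
qed

lemma rotor_step_None: "(rotor_step g ^^ n) (\<rho>, None) = (\<rho>, None)"
  by (induction n) auto

lemma hitting_timeI:
  assumes "rotor_walk g x \<rho> n = (\<tau>, Some w)" "rotor_walk g x \<rho> (Suc n) = (\<sigma>, None)"
  shows "hitting_time g x \<rho> = Suc n" "route g x \<rho> = \<sigma>"
    "last_edge g x \<rho> = (w, \<sigma> w)"
proof -
  have "snd (rotor_walk g x \<rho> m) \<noteq> None" if "m \<le> n" for m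
  proof
    assume "snd (rotor_walk g x \<rho> m) = None"
    then obtain \<tau>' where "rotor_walk g x \<rho> m = (\<tau>', None)" by (metis prod.collapse)
    then have "rotor_walk g x \<rho> n = (\<tau>', None)"
      using funpow_split[OF that, of "rotor_step g"] rotor_step_None by (simp add: rotor_walk_def)
    then show False using assms by simp
  qed
  then show h: "hitting_time g x \<rho> = Suc n"
    unfolding hitting_time_def using assms(2)
    by (intro Least_equality) (simp, meson not_less_eq_eq)
  then show r: "route g x \<rho> = \<sigma>" using assms by (simp add: route_def)
  show "last_edge g x \<rho> = (w, \<sigma> w)" using assms r h by (simp add: last_edge_def)
qed

lemma route_eqI:
  assumes "rotor_walk g x \<rho> n = (\<sigma>, None)"
  shows "route g x \<rho> = \<sigma>"
proof -
  define m where "m = hitting_time g x \<rho>"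
  have "snd (rotor_walk g x \<rho> m) = None" "m \<le> n"
    unfolding m_def hitting_time_def using assms
    by (metis (mono_tags, lifting) LeastI snd_conv) (metis (mono_tags, lifting) Least_le assms snd_conv)
  then obtain \<tau> where "rotor_walk g x \<rho> m = (\<tau>, None)" by (metis prod.collapse)
  moreover from this have "rotor_walk g x \<rho> n = (\<tau>, None)"
    using funpow_split[OF \<open>m \<le> n\<close>, of "rotor_step g"] rotor_step_None by (simp add: rotor_walk_def)
  ultimately show ?thesis using assms by (simp add: route_def m_def)
qed

text \<open>
Termination of the walk comes from reversibility: the reentrant step permutes the finite set of
unicycles, so the state with its particle at the sink recurs, and with it the sink is reached again.
\<open>(\<tau>, Some w)\<close> is the state before the last step.
\<close>

lemma first_return_to_sink:
  assumes x: "x \<in> inner g" and \<rho>: "\<rho> \<in> recurrent_configs g"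
  obtains n \<tau> w where
    "(reentrant_step x ^^ Suc n) (\<rho>, None) = (\<tau>, Some w)" "(\<tau>, Some w) \<in> unicycles x"
    "rotor_walk g x \<rho> n = (\<tau>, Some w)"
    "reentrant_step x (\<tau>, Some w) = (route g x \<rho>, None)"
    "rotor_step g (\<tau>, Some w) = (route g x \<rho>, None)"
    "last_edge g x \<rho> = (w, route g x \<rho> w)"
    "\<And>m. 0 < m \<Longrightarrow> m \<le> Suc n \<Longrightarrow> snd ((reentrant_step x ^^ m) (\<rho>, None)) \<noteq> None"
proof -
  let ?T = "reentrant_step x"
  have U: "(\<rho>, None) \<in> unicycles x" using \<rho> recurrent_iff_unicycle by simp
  define P where "P n \<longleftrightarrow> 0 < n \<and> snd ((?T ^^ n) (\<rho>, None)) = None" for n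
  have "\<exists>n. P n"
    using funpow_recurs[OF finite_unicycles reentrant_step_unicycles[OF x] inj_on_reentrant_step[OF x] U]
    unfolding P_def by (metis snd_conv)
  \<comment> \<open>The first return takes at least two steps, the first one leads from the sink to \<open>x\<close>.\<close>
  define N where "N = (LEAST n. P n)"
  have N: "P N" unfolding N_def using \<open>\<exists>n. P n\<close> by (rule LeastI_ex)
  have before: "snd ((?T ^^ m) (\<rho>, None)) \<noteq> None" if "0 < m" "m < N" for m
    using not_less_Least[of m P] that unfolding N_def[symmetric] by (simp add: P_def)
  have walk: "(?T ^^ Suc m) (\<rho>, None) = rotor_walk g x \<rho> m" if "m < N" for m
    using that
  proof (induction m)
    case 0
    then show ?case by (simp add: rotor_walk_def)
  next
    case (Suc m)
    then have IH: "(?T ^^ Suc m) (\<rho>, None) = rotor_walk g x \<rho> m" by simp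
    obtain \<tau> w where "rotor_walk g x \<rho> m = (\<tau>, Some w)"
      using before[of "Suc m"] Suc IH by (metis not_None_eq prod.collapse zero_less_Suc)
    then show ?case using IH unfolding rotor_walk_def by simp
  qed
  have "N \<noteq> 1" using N by (auto simp: P_def)
  then obtain n where n: "N = Suc (Suc n)" using N unfolding P_def by (metis One_nat_def not0_implies_Suc not_gr_zero)
  obtain \<tau> w where tw: "(?T ^^ Suc n) (\<rho>, None) = (\<tau>, Some w)"
    using before[of "Suc n"] n by (metis lessI not_None_eq prod.collapse zero_less_Suc)
  obtain \<sigma> where s: "(?T ^^ Suc (Suc n)) (\<rho>, None) = (\<sigma>, None)"
    using N n unfolding P_def by (metis prod.collapse)
  have w: "rotor_walk g x \<rho> n = (\<tau>, Some w)" "rotor_walk g x \<rho> (Suc n) = (\<sigma>, None)"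
    using walk[of n] walk[of "Suc n"] n tw s by auto
  note h = hitting_timeI[OF w]
  have s': "rotor_step g (\<tau>, Some w) = (\<sigma>, None)" using s tw by simp
  show thesis
  proof (rule that[OF tw _ w(1)])
    show "(\<tau>, Some w) \<in> unicycles x"
      using funpow_in[OF reentrant_step_unicycles[OF x] U, of "Suc n"] tw by metis
  qed (use s' h before n in auto)
qed

lemma route_recurrent:
  assumes "x \<in> inner g" "\<rho> \<in> recurrent_configs g"
  shows "route g x \<rho> \<in> recurrent_configs g"
proof -
  obtain \<tau> w where "(\<tau>, Some w) \<in> unicycles x" "reentrant_step x (\<tau>, Some w) = (route g x \<rho>, None)"
    using first_return_to_sink[OF assms] by metis
  then have "(route g x \<rho>, None) \<in> unicycles x"
    using reentrant_step_unicycles[OF assms(1)] by (metis image_subset_iff)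
  then show ?thesis using recurrent_iff_unicycle by blast
qed

text \<open>
The final rotors lead from \<open>x\<close> along the loop erasure of the walk; all that matters here is that they
pass the last vertex, as this vertex was the position of the particle in a unicycle.
\<close>

lemma last_edge_on_rotor_path:
  assumes "x \<in> inner g" "\<rho> \<in> recurrent_configs g"
  obtains w n where "last_edge g x \<rho> = (w, route g x \<rho> w)" "w \<in> inner g"
    "nbr g w (route g x \<rho> w) = None" "(rotor_target x (route g x \<rho>) ^^ n) (Some x) = Some w"
proof -
  obtain \<tau> w where U: "(\<tau>, Some w) \<in> unicycles x"
    and s: "reentrant_step x (\<tau>, Some w) = (route g x \<rho>, None)"
    and e: "last_edge g x \<rho> = (w, route g x \<rho> w)"
    using first_return_to_sink[OF assms] by metis
  note v = reentrant_step_vertex[OF U s assms(1)]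
  obtain n where n: "(rotor_target x (route g x \<rho>) ^^ n) None = Some w" using v(2) by blast
  then obtain m where "n = Suc m" by (cases n) auto
  then have "(rotor_target x (route g x \<rho>) ^^ m) (Some x) = Some w"
    using n by (simp del: funpow.simps add: funpow_Suc_right)
  moreover have "w \<in> inner g" using U by (auto simp: unicycles_def)
  ultimately show thesis using that e v(1) by simp
qed

text \<open>
Run both walks backwards from their common end. As steps are reversible, the shorter walk is a final
part of the longer one, and it starts at the sink, which the longer one avoids in between.
\<close>

lemma inj_on_route:
  assumes x: "x \<in> inner g"
  shows "inj_on (route g x) (recurrent_configs g)"
proof -
  let ?T = "reentrant_step x"
  have main: "\<rho>1 = \<rho>2"
    if r: "\<rho>1 \<in> recurrent_configs g" "\<rho>2 \<in> recurrent_configs g" and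
      n: "(?T ^^ n1) (\<rho>1, None) = (\<sigma>, None)" "(?T ^^ n2) (\<rho>2, None) = (\<sigma>, None)"
      "\<And>m. 0 < m \<Longrightarrow> m < n2 \<Longrightarrow> snd ((?T ^^ m) (\<rho>2, None)) \<noteq> None"
      and "n1 \<le> n2" "0 < n1" for \<rho>1 \<rho>2 \<sigma> n1 n2
  proof -
    have U: "(\<rho>1, None) \<in> unicycles x" "(\<rho>2, None) \<in> unicycles x"
      using r recurrent_iff_unicycle by auto
    have "(?T ^^ n1) ((?T ^^ (n2 - n1)) (\<rho>2, None)) = (?T ^^ n1) (\<rho>1, None)"
      using n funpow_split[of "n2 - n1" n2 ?T "(\<rho>2, None)"] \<open>n1 \<le> n2\<close> by simp
    then have "(?T ^^ (n2 - n1)) (\<rho>2, None) = (\<rho>1, None)"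
      using inj_on_funpow[OF reentrant_step_unicycles[OF x] inj_on_reentrant_step[OF x]] U
        funpow_in[OF reentrant_step_unicycles[OF x] U(2)] by (meson inj_onD)
    moreover from this have "n2 - n1 = 0"
      using n(3)[of "n2 - n1"] \<open>0 < n1\<close> by fastforce
    ultimately show ?thesis by simp
  qed
  show ?thesis
  proof (rule inj_onI)
    fix \<rho>1 \<rho>2 assume r: "\<rho>1 \<in> recurrent_configs g" "\<rho>2 \<in> recurrent_configs g"
      and eq: "route g x \<rho>1 = route g x \<rho>2"
    have ex: "\<exists>n>0. (?T ^^ n) (\<rho>, None) = (route g x \<rho>, None) \<and>
        (\<forall>m. 0 < m \<and> m < n \<longrightarrow> snd ((?T ^^ m) (\<rho>, None)) \<noteq> None)"
      if \<rho>: "\<rho> \<in> recurrent_configs g" for \<rho>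
    proof -
      obtain n \<tau> w where *: "(?T ^^ Suc n) (\<rho>, None) = (\<tau>, Some w)"
        "?T (\<tau>, Some w) = (route g x \<rho>, None)"
        "\<And>m. 0 < m \<Longrightarrow> m \<le> Suc n \<Longrightarrow> snd ((?T ^^ m) (\<rho>, None)) \<noteq> None"
        using first_return_to_sink[OF x \<rho>] by metis
      then have "(?T ^^ Suc (Suc n)) (\<rho>, None) = (route g x \<rho>, None)" by simp
      then show ?thesis using *(3) by (metis less_Suc_eq_le zero_less_Suc)
    qed
    obtain n1 n2 where "0 < n1" "(?T ^^ n1) (\<rho>1, None) = (route g x \<rho>1, None)"
      "\<forall>m. 0 < m \<and> m < n1 \<longrightarrow> snd ((?T ^^ m) (\<rho>1, None)) \<noteq> None"
      "0 < n2" "(?T ^^ n2) (\<rho>2, None) = (route g x \<rho>2, None)"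
      "\<forall>m. 0 < m \<and> m < n2 \<longrightarrow> snd ((?T ^^ m) (\<rho>2, None)) \<noteq> None"
      using ex r by metis
    then show "\<rho>1 = \<rho>2"
      using main[OF r, of n1 _ n2] main[OF r(2,1), of n2 _ n1] eq by (metis nat_le_linear)
  qed
qed

lemma rotor_walk_closed:
  assumes "\<rho> \<in> rotor_configs g" "x \<in> inner g"
  shows "fst (rotor_walk g x \<rho> n) \<in> rotor_configs g \<and> snd (rotor_walk g x \<rho> n) \<in> vertices"
proof (induction n)
  case (Suc n)
  obtain \<sigma> p where \<sigma>: "rotor_walk g x \<rho> n = (\<sigma>, p)" by fastforce
  have step: "rotor_walk g x \<rho> (Suc n) = rotor_step g (\<sigma>, p)"
    using \<sigma> by (simp add: rotor_walk_def)
  show ?case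
  proof (cases p)
    case (Some v)
    then have "\<sigma> \<in> rotor_configs g" "v \<in> inner g" using Suc \<sigma> by simp_all
    note r = rotor_step_inner[OF this]
    show ?thesis
      unfolding step Some r(1) fst_conv snd_conv by (intro conjI r(2,3))
  qed (use Suc \<sigma> step in simp)
qed (use assms in \<open>simp add: rotor_walk_def\<close>)

lemma rr_element_Bij:
  assumes "x \<in> inner g"
  shows "rr_element g x \<in> Bij (recurrent_configs g)"
proof -
  have "route g x ` recurrent_configs g = recurrent_configs g"
    using route_recurrent[OF assms] inj_on_route[OF assms] finite_recurrent_configs
    by (intro endo_inj_surj) auto
  then show ?thesis
    using inj_on_route[OF assms] by (simp add: Bij_def rr_element_def bij_betw_def)
qed

lemma group_rotor_router: "group (rotor_router_group g)"
proof -
  interpret B: group "BijGroup (recurrent_configs g)" by (rule group_BijGroup)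
  have "rr_element g ` inner g \<subseteq> carrier (BijGroup (recurrent_configs g))"
    using rr_element_Bij by (auto simp: BijGroup_def)
  then show ?thesis
    unfolding rotor_router_group_def Let_def by (rule B.subgroup_imp_group[OF B.generate_is_subgroup])
qed

lemma rr_element_pow:
  assumes "x \<in> inner g"
  shows "rr_element g x [^]\<^bsub>rotor_router_group g\<^esub> (n::nat) = restrict (route g x ^^ n) (recurrent_configs g)"
proof (induction n)
  case 0
  then show ?case by (simp add: nat_pow_def rotor_router_group_def BijGroup_def Let_def restrict_def)
next
  case (Suc n)
  let ?B = "BijGroup (recurrent_configs g)" and ?e = "rr_element g x"
  interpret B: group ?B by (rule group_BijGroup)
  have e: "?e \<in> carrier ?B" using rr_element_Bij[OF assms] by (simp add: BijGroup_def)
  have pow: "?e [^]\<^bsub>rotor_router_group g\<^esub> k = ?e [^]\<^bsub>?B\<^esub> k" for k :: nat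
    by (simp add: nat_pow_def rotor_router_group_def Let_def)
  have "?e [^]\<^bsub>?B\<^esub> Suc n = ?e [^]\<^bsub>?B\<^esub> n \<otimes>\<^bsub>?B\<^esub> ?e" by simp
  also have "\<dots> = ?e \<otimes>\<^bsub>?B\<^esub> ?e [^]\<^bsub>?B\<^esub> n" using e by (simp add: B.nat_pow_Suc2[symmetric])
  also have "\<dots> = compose (recurrent_configs g) ?e (?e [^]\<^bsub>?B\<^esub> n)"
    using e B.nat_pow_closed[OF e, of n] by (simp add: BijGroup_def)
  also have "\<dots> = restrict (route g x ^^ Suc n) (recurrent_configs g)"
  proof -
    have "(route g x ^^ n) \<rho> \<in> recurrent_configs g" if "\<rho> \<in> recurrent_configs g" for \<rho>
      using funpow_in[of "route g x"] route_recurrent[OF assms] that by blast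
    then show ?thesis
      using Suc unfolding pow by (auto simp: compose_def rr_element_def restrict_def)
  qed
  finally show ?case unfolding pow .
qed

text \<open>
The period is assumed to be the same at all configurations; it is then the order of the permutation.
\<close>

lemma ord_rr_element:
  assumes x: "x \<in> inner g" and ne: "recurrent_configs g \<noteq> {}"
    and period: "\<And>\<rho> N. \<rho> \<in> recurrent_configs g \<Longrightarrow> (route g x ^^ N) \<rho> = \<rho> \<longleftrightarrow> R dvd N"
  shows "group.ord (rotor_router_group g) (rr_element g x) = R"
proof -
  interpret group "rotor_router_group g" by (rule group_rotor_router)
  have "rr_element g x \<in> carrier (rotor_router_group g)"
    using x by (auto simp: rotor_router_group_def Let_def intro: generate.incl)
  moreover have "rr_element g x [^]\<^bsub>rotor_router_group g\<^esub> N = \<one>\<^bsub>rotor_router_group g\<^esub> \<longleftrightarrow> R dvd N" for N :: nat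
  proof -
    have "restrict (route g x ^^ N) (recurrent_configs g) = (\<lambda>\<rho>\<in>recurrent_configs g. \<rho>) \<longleftrightarrow>
      (\<forall>\<rho>\<in>recurrent_configs g. (route g x ^^ N) \<rho> = \<rho>)"
      by (auto simp: fun_eq_iff restrict_def)
    then show ?thesis
      using period ne unfolding rr_element_pow[OF x]
      by (auto simp: rotor_router_group_def BijGroup_def Let_def)
  qed
  ultimately show ?thesis using ord_unique by blast
qed

end

section \<open>Induced maps and counting over a period\<close>

lemma card_periodic:
  fixes A :: "nat \<Rightarrow> bool"
  assumes "\<And>s. A (s + P) = A s"
  shows "card {s. s < m * P \<and> A s} = m * card {s. s < P \<and> A s}"
proof (induction m)
  case (Suc m)
  have shift: "A (s + m * P) = A s" for s m
    by (induction m) (use assms in \<open>simp_all add: add.assoc[symmetric] add.commute[of P]\<close>)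
  have "{s. s < Suc m * P \<and> A s} = {s. s < m * P \<and> A s} \<union> (\<lambda>s. s + m * P) ` {s. s < P \<and> A s}"
  proof (intro equalityI subsetI)
    fix s assume s: "s \<in> {s. s < Suc m * P \<and> A s}"
    show "s \<in> {s. s < m * P \<and> A s} \<union> (\<lambda>s. s + m * P) ` {s. s < P \<and> A s}"
    proof (cases "s < m * P")
      case False
      then have "s = (s - m * P) + m * P" by simp
      moreover have "s - m * P < P" "A (s - m * P)"
        using s False shift[of "s - m * P" m] by auto
      ultimately show ?thesis by blast
    qed (use s in auto)
  qed (auto simp: shift)
  moreover have "card ((\<lambda>s. s + m * P) ` {s. s < P \<and> A s}) = card {s. s < P \<and> A s}"
    by (rule card_image) (auto simp: inj_on_def)
  ultimately show ?case
    using Suc by (simp add: card_Un_disjoint disjoint_iff image_iff)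
qed simp

text \<open>
\<open>E\<close> is a first return map of \<open>M\<close> to \<open>Z\<close>, but only on a set \<open>C\<close> that it preserves. The \<open>E\<close>-orbit of
\<open>x\<close> is then the \<open>M\<close>-orbit with everything outside \<open>Z\<close> left out: the \<open>n\<close>-th return time \<open>T n\<close> is
characterised by having exactly \<open>n\<close> earlier visits to \<open>Z\<close>, and the return times are compared with
the multiples of \<open>P\<close> by counting visits.
\<close>

lemma induced_map_period:
  fixes M E :: "'s \<Rightarrow> 's"
  assumes period: "0 < P" "\<And>t. (M ^^ t) x = x \<longleftrightarrow> P dvd t"
    and C: "x \<in> C" "\<And>z. z \<in> C \<Longrightarrow> E z \<in> C" "C \<subseteq> Z"
    and return: "\<And>z. z \<in> C \<Longrightarrow> \<exists>\<tau>>0. E z = (M ^^ \<tau>) z \<and> (\<forall>s. 0 < s \<and> s < \<tau> \<longrightarrow> (M ^^ s) z \<notin> Z)"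
  defines "R \<equiv> card {t. t < P \<and> (M ^^ t) x \<in> Z}"
  shows "0 < R" "(E ^^ N) x = x \<longleftrightarrow> R dvd N"
    "card {N. N < R \<and> Q ((E ^^ N) x)} = card {t. t < P \<and> (M ^^ t) x \<in> Z \<and> Q ((M ^^ t) x)}"
proof -
  obtain \<tau> where \<tau>: "\<And>z. z \<in> C \<Longrightarrow> 0 < \<tau> z" "\<And>z. z \<in> C \<Longrightarrow> E z = (M ^^ \<tau> z) z"
    "\<And>z s. z \<in> C \<Longrightarrow> 0 < s \<Longrightarrow> s < \<tau> z \<Longrightarrow> (M ^^ s) z \<notin> Z"
    using return by metis
  define T where "T n = (\<Sum>j<n. \<tau> ((E ^^ j) x))" for n
  define cnt where "cnt t = card {s. s < t \<and> (M ^^ s) x \<in> Z}" for t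
  have EC: "(E ^^ n) x \<in> C" for n
    using funpow_in[of E C] C by blast
  have ET: "(E ^^ n) x = (M ^^ T n) x" for n
  proof (induction n)
    case (Suc n)
    have "(M ^^ T (Suc n)) x = (M ^^ \<tau> ((E ^^ n) x)) ((M ^^ T n) x)"
      by (simp add: T_def funpow_add add.commute)
    then show ?case using Suc \<tau>(2)[OF EC, of n] by simp
  qed (simp add: T_def)
  have TZ: "(M ^^ T n) x \<in> Z" for n
    using EC ET C(3) by (metis subsetD)
  have T_mono: "strict_mono T"
    unfolding strict_mono_Suc_iff T_def using \<tau>(1)[OF EC] by simp
  have cnt_less: "cnt s < cnt t" if "s < t" "(M ^^ s) x \<in> Z" for s t
    unfolding cnt_def using that by (intro psubset_card_mono) auto
  have cnt_T: "cnt (T n) = n" for n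
  proof (induction n)
    case (Suc n)
    have "{s. s < T (Suc n) \<and> (M ^^ s) x \<in> Z} = insert (T n) {s. s < T n \<and> (M ^^ s) x \<in> Z}"
    proof (intro equalityI subsetI)
      fix s assume s: "s \<in> {s. s < T (Suc n) \<and> (M ^^ s) x \<in> Z}"
      have "\<not> T n < s"
      proof
        assume less: "T n < s"
        then have "(M ^^ s) x = (M ^^ (s - T n)) ((E ^^ n) x)"
          using funpow_split[of "T n" s M x] ET by simp
        moreover have "s - T n < \<tau> ((E ^^ n) x)" using s less by (auto simp: T_def)
        ultimately show False using \<tau>(3)[OF EC, of "s - T n" n] s less by simp
      qed
      then show "s \<in> insert (T n) {s. s < T n \<and> (M ^^ s) x \<in> Z}" using s by auto
    next
      fix s assume "s \<in> insert (T n) {s. s < T n \<and> (M ^^ s) x \<in> Z}"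
      then show "s \<in> {s. s < T (Suc n) \<and> (M ^^ s) x \<in> Z}"
        using strict_monoD[OF T_mono, of n "Suc n"] TZ by auto
    qed
    then show ?case using Suc by (simp add: cnt_def)
  qed (simp add: T_def cnt_def)
  \<comment> \<open>Two visits to \<open>Z\<close> with equally many earlier visits are the same visit.\<close>
  have T_eqI: "T (cnt t) = t" if "(M ^^ t) x \<in> Z" for t
    using cnt_less[of t "T (cnt t)"] cnt_less[of "T (cnt t)" t] that TZ cnt_T
    by (metis linorder_neqE_nat nat_less_le)
  have "(M ^^ (s + P)) x = (M ^^ s) x" for s
    using period(2)[of P] by (simp add: funpow_add)
  then have cnt_P: "cnt (m * P) = m * R" for m
    unfolding cnt_def R_def by (intro card_periodic) simp
  have mP: "(M ^^ (m * P)) x \<in> Z" for m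
    using period(2)[of "m * P"] C by auto
  have T_R: "T (m * R) = m * P" for m
    using T_eqI[OF mP] cnt_P by simp
  show "0 < R"
    unfolding R_def using period(1) C by (subst card_gt_0_iff) (auto intro!: exI[of _ 0])
  show "(E ^^ N) x = x \<longleftrightarrow> R dvd N"
  proof -
    have "P dvd T N \<longleftrightarrow> R dvd N"
      using cnt_T cnt_P T_R by (metis dvd_def mult.commute)
    then show ?thesis using ET period(2) by simp
  qed
  have "bij_betw T {N. N < R \<and> Q ((E ^^ N) x)} {t. t < P \<and> (M ^^ t) x \<in> Z \<and> Q ((M ^^ t) x)}"
  proof (rule bij_betwI')
    fix a b show "(T a = T b) = (a = b)" using T_mono by (simp add: strict_mono_eq)
  next
    fix N assume "N \<in> {N. N < R \<and> Q ((E ^^ N) x)}"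
    then show "T N \<in> {t. t < P \<and> (M ^^ t) x \<in> Z \<and> Q ((M ^^ t) x)}"
      using strict_monoD[OF T_mono, of N R] T_R[of 1] TZ ET by auto
  next
    fix t assume t: "t \<in> {t. t < P \<and> (M ^^ t) x \<in> Z \<and> Q ((M ^^ t) x)}"
    then have "cnt t < R" using cnt_less[of t P] cnt_P[of 1] by simp
    then show "\<exists>N\<in>{N. N < R \<and> Q ((E ^^ N) x)}. t = T N"
      using T_eqI[of t] t ET[of "cnt t"] by (intro bexI[of _ "cnt t"]) auto
  qed
  then show "card {N. N < R \<and> Q ((E ^^ N) x)} = card {t. t < P \<and> (M ^^ t) x \<in> Z \<and> Q ((M ^^ t) x)}"
    by (rule bij_betw_same_card)
qed

lemma add_mod_left_cancel:
  fixes a s t q :: nat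
  shows "(a + t) mod q = (a + s) mod q \<longleftrightarrow> t mod q = s mod q"
  unfolding nat_mod_eq_iff by (simp add: add.assoc)

text \<open>
For a rotor with \<open>q\<close> positions that starts at \<open>a\<close>, the expression
\<open>(a + q - k + t) div q - (a + q - k) div q\<close> is the number of times that it has moved to position \<open>k\<close>
within \<open>t\<close> steps. In \<open>L\<close> full rotations it is at \<open>k\<close> exactly \<open>L\<close> times, and then the number of moves
to \<open>k\<close> takes \<open>L\<close> consecutive values. They start at 0 if the rotor starts at \<open>k\<close>, since time 0 then
counts as a visit without a move; otherwise they start at 1.
\<close>

lemma card_residue_visits:
  fixes a k q :: nat and A :: "nat \<Rightarrow> bool"
  assumes "a < q" "k < q"
  shows "card {t. t < L * q \<and> (a + t) mod q = k \<and> A ((a + q - k + t) div q - (a + q - k) div q)} =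
    card {n. n < L \<and> A (n + (if a = k then 0 else 1))}"
proof -
  \<comment> \<open>The first time at which the rotor is at \<open>k\<close>.\<close>
  define t0 where "t0 = (if a \<le> k then k - a else k + q - a)"
  have t0: "t0 < q" "(a + t0) mod q = k" using assms by (auto simp: t0_def)
  have visits: "(a + q - k + (n * q + t0)) div q - (a + q - k) div q = n + (if a = k then 0 else 1)" for n
  proof -
    have 1: "a + q - k + (n * q + t0) = (n + (if a \<le> k then 1 else 2)) * q"
      using assms by (auto simp: t0_def algebra_simps)
    have "(a + q - k) div q = (if a < k then 0 else 1)"
    proof (cases "a < k")
      case False
      then have "a + q - k = q + (a - k)" by simp
      moreover have "(q + (a - k)) div q = 1"
        using assms by (subst div_add_self1) auto
      ultimately show ?thesis using False by simp
    qed (use assms in simp)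
    then show ?thesis unfolding 1 using assms by auto
  qed
  have residue: "(a + t) mod q = k \<longleftrightarrow> t mod q = t0" for t
  proof -
    have "(a + t) mod q = (a + t0) mod q \<longleftrightarrow> t mod q = t0 mod q"
      by (rule add_mod_left_cancel)
    then show ?thesis using t0 by simp
  qed
  have "bij_betw (\<lambda>n. n * q + t0) {n. n < L \<and> A (n + (if a = k then 0 else 1))}
     {t. t < L * q \<and> (a + t) mod q = k \<and> A ((a + q - k + t) div q - (a + q - k) div q)}"
  proof (rule bij_betwI')
    fix m n show "(m * q + t0 = n * q + t0) = (m = n)" using assms by auto
  next
    fix n assume n: "n \<in> {n. n < L \<and> A (n + (if a = k then 0 else 1))}"
    have "n * q + t0 < Suc n * q" using t0 by simp
    also have "\<dots> \<le> L * q" using n by (intro mult_le_mono1) simp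
    finally show "n * q + t0 \<in> {t. t < L * q \<and> (a + t) mod q = k \<and> A ((a + q - k + t) div q - (a + q - k) div q)}"
      using n t0 by (simp only: mem_Collect_eq visits residue) simp
  next
    fix t assume t: "t \<in> {t. t < L * q \<and> (a + t) mod q = k \<and> A ((a + q - k + t) div q - (a + q - k) div q)}"
    then have "t mod q = t0" using residue by blast
    then obtain n where n: "t = n * q + t0" using div_mult_mod_eq[of t q] by metis
    have "n * q + t0 < L * q" using t unfolding n by simp
    then have "n * q < L * q" by linarith
    then have "n < L" by simp
    then show "\<exists>n\<in>{n. n < L \<and> A (n + (if a = k then 0 else 1))}. t = n * q + t0"
      using t n unfolding n mem_Collect_eq visits by blast
  qed
  then show ?thesis by (rule bij_betw_same_card[symmetric])
qed

section \<open>Wired directed covers and their branches\<close>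

lemma vertex_type_Cons [simp]: "vertex_type \<chi> i (k # x) = vertex_type \<chi> (\<chi> i k) x"
  by (simp add: vertex_type_def)

text \<open>
Addresses are generated by appending at the far end; the recursion over the height needs them split
at the root.
\<close>

lemma cover_addresses_Cons:
  "k # x \<in> cover_addresses G \<chi> i \<longleftrightarrow>
     k \<in> {1..outdeg G i} \<and> x \<in> cover_addresses G \<chi> (\<chi> i k)"
proof
  have "y = k # x \<Longrightarrow> k \<in> {1..outdeg G i} \<and> x \<in> cover_addresses G \<chi> (\<chi> i k)"
    if "y \<in> cover_addresses G \<chi> i" for y
    using that
  proof (induction arbitrary: x)
    case (child z c)
    show ?case
    proof (cases z)
      case Nil
      then show ?thesis using child by (auto simp: vertex_type_def intro: cover_addresses.root)
    next
      case (Cons a z')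
      then show ?thesis using child by (auto intro: cover_addresses.child)
    qed
  qed simp
  then show "k # x \<in> cover_addresses G \<chi> i \<Longrightarrow>
    k \<in> {1..outdeg G i} \<and> x \<in> cover_addresses G \<chi> (\<chi> i k)" by blast
next
  assume *: "k \<in> {1..outdeg G i} \<and> x \<in> cover_addresses G \<chi> (\<chi> i k)"
  then have "x \<in> cover_addresses G \<chi> (\<chi> i k)" by simp
  then show "k # x \<in> cover_addresses G \<chi> i"
  proof induction
    case root
    then show ?case
      using cover_addresses.child[OF cover_addresses.root, of k G \<chi> i] * by (simp add: vertex_type_def)
  next
    case (child x c)
    then show ?case using cover_addresses.child[of "k # x" G \<chi> i c] by simp
  qed
qed

lemma inner_wired_cover:
  "0 < h \<Longrightarrow> inner (wired_cover G \<chi> h i) = Node ` {x \<in> cover_addresses G \<chi> i. length x < h}"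
  by (force simp: wired_cover_def truncated_cover_def sink_down_def sink_up_def Let_def)

lemma deg_wired_cover [simp]: "deg (wired_cover G \<chi> h i) = cover_deg G \<chi> i"
  by (simp add: wired_cover_def Let_def)

lemma root_inner: "0 < h \<Longrightarrow> Node [] \<in> inner (wired_cover G \<chi> h i)"
  by (simp add: inner_wired_cover cover_addresses.root)

lemma nbr_wired_cover_parent:
  assumes "0 < h"
  shows "nbr (wired_cover G \<chi> h i) (Node []) 0 = None"
    and "length x < h \<Longrightarrow> x \<noteq> [] \<Longrightarrow> nbr (wired_cover G \<chi> h i) (Node x) 0 = Some (Node (butlast x))"
  by (auto simp: wired_cover_def Let_def contract_def sink_down_def sink_up_def)

lemma nbr_wired_cover_child:
  assumes "x \<in> cover_addresses G \<chi> i" "e \<in> {1..outdeg G (vertex_type \<chi> i x)}"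
  shows "nbr (wired_cover G \<chi> h i) (Node x) e =
    (if Suc (length x) = h then None else Some (Node (x @ [e])))"
proof -
  obtain e' where "e = Suc e'" using assms by (cases e) auto
  then show ?thesis
    using cover_addresses.child[OF assms]
    by (auto simp: wired_cover_def Let_def contract_def sink_down_def sink_up_def)
qed

text \<open>
The embedding of a directed cover as the \<open>k\<close>-th branch of a larger one. The ancestor goes to the root,
so that particles stopped down in the branch are those that return to the root.
\<close>

fun graft :: "nat \<Rightarrow> cover_vertex \<Rightarrow> cover_vertex" where
  "graft k Anc = Node []"
| "graft k (Node x) = Node (k # x)"

text \<open>
The value at \<open>Anc\<close> is chosen such that the restriction of a rotor configuration is extensional and thus
again a rotor configuration.
\<close>

definition branch :: "nat \<Rightarrow> (cover_vertex \<Rightarrow> nat) \<Rightarrow> cover_vertex \<Rightarrow> nat" where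
  "branch k \<rho> v = (if v = Anc then undefined else \<rho> (graft k v))"

fun replace_branch :: "nat \<Rightarrow> (cover_vertex \<Rightarrow> nat) \<Rightarrow> (cover_vertex \<Rightarrow> nat) \<Rightarrow> cover_vertex \<Rightarrow> nat" where
  "replace_branch k \<sigma> \<rho> (Node (j # x)) = (if j = k then \<sigma> (Node x) else \<rho> (Node (j # x)))"
| "replace_branch k \<sigma> \<rho> (Node []) = \<rho> (Node [])"
| "replace_branch k \<sigma> \<rho> Anc = \<rho> Anc"

lemma inner_wired_cover_Suc:
  assumes "0 < h"
  shows "inner (wired_cover G \<chi> (Suc h) i) =
    insert (Node []) (\<Union>k\<in>{1..outdeg G i}. graft k ` inner (wired_cover G \<chi> h (\<chi> i k)))"
proof (intro equalityI subsetI)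
  fix v assume "v \<in> inner (wired_cover G \<chi> (Suc h) i)"
  then obtain x where "v = Node x" "x \<in> cover_addresses G \<chi> i" "length x < Suc h"
    by (auto simp: inner_wired_cover)
  then show "v \<in> insert (Node []) (\<Union>k\<in>{1..outdeg G i}. graft k ` inner (wired_cover G \<chi> h (\<chi> i k)))"
    using assms by (cases x) (force simp: inner_wired_cover cover_addresses_Cons)+
next
  fix v assume "v \<in> insert (Node []) (\<Union>k\<in>{1..outdeg G i}. graft k ` inner (wired_cover G \<chi> h (\<chi> i k)))"
  then show "v \<in> inner (wired_cover G \<chi> (Suc h) i)"
    using assms by (auto simp: inner_wired_cover cover_addresses_Cons cover_addresses.root)
qed

lemma finite_inner_wired_cover: "0 < h \<Longrightarrow> finite (inner (wired_cover G \<chi> h i))"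
proof (induction h arbitrary: i)
  case (Suc h)
  show ?case
  proof (cases "h = 0")
    case True
    then have "inner (wired_cover G \<chi> (Suc h) i) \<subseteq> {Node []}" by (auto simp: inner_wired_cover)
    then show ?thesis using finite_subset by blast
  qed (use Suc inner_wired_cover_Suc[of h G \<chi> i] in auto)
qed simp

lemma finite_sink_graph_wired_cover:
  assumes "0 < h"
  shows "finite_sink_graph (wired_cover G \<chi> h i)"
proof
  show "finite (inner (wired_cover G \<chi> h i))" using assms by (rule finite_inner_wired_cover)
next
  fix v k assume v: "v \<in> inner (wired_cover G \<chi> h i)" and k: "k < deg (wired_cover G \<chi> h i) v"
  then obtain x where x: "v = Node x" "x \<in> cover_addresses G \<chi> i" "length x < h"
    using assms by (auto simp: inner_wired_cover)
  show "nbr (wired_cover G \<chi> h i) v k \<in> insert None (Some ` inner (wired_cover G \<chi> h i))"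
  proof (cases "k = 0")
    case True
    show ?thesis
    proof (cases "x = []")
      case False
      have "butlast x \<in> cover_addresses G \<chi> i"
        using x(2) False by cases auto
      then show ?thesis
        using True False x nbr_wired_cover_parent(2)[OF assms, where x=x and G=G and \<chi>=\<chi> and i=i] assms
        by (simp add: inner_wired_cover)
    qed (use True x nbr_wired_cover_parent(1)[OF assms, of G \<chi> i] in simp)
  next
    case False
    then have "k \<in> {1..outdeg G (vertex_type \<chi> i x)}" using k x by auto
    then show ?thesis
      using nbr_wired_cover_child[OF x(2)] cover_addresses.child[OF x(2)] x assms
      by (simp add: inner_wired_cover)
  qed
qed

lemma graft_inner:
  assumes "0 < h" "k \<in> {1..outdeg G i}" "v \<in> inner (wired_cover G \<chi> h (\<chi> i k))"
  shows "graft k v \<in> inner (wired_cover G \<chi> (Suc h) i)"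
    "cover_deg G \<chi> i (graft k v) = cover_deg G \<chi> (\<chi> i k) v"
  using assms by (auto simp: inner_wired_cover cover_addresses_Cons)

text \<open>
A branch and the surrounding cover have the same edges and the same upper sink; only the edge from the
root of the branch to its ancestor no longer ends in the sink.
\<close>

lemma nbr_graft:
  assumes "0 < h" "k \<in> {1..outdeg G i}" "v \<in> inner (wired_cover G \<chi> h (\<chi> i k))"
    and "e < cover_deg G \<chi> (\<chi> i k) v"
  shows "nbr (wired_cover G \<chi> (Suc h) i) (graft k v) e =
    (if v = Node [] \<and> e = 0 then Some (Node [])
     else map_option (graft k) (nbr (wired_cover G \<chi> h (\<chi> i k)) v e))"
proof -
  obtain x where x: "v = Node x" "x \<in> cover_addresses G \<chi> (\<chi> i k)" "length x < h"
    using assms by (auto simp: inner_wired_cover)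
  then have kx: "k # x \<in> cover_addresses G \<chi> i" using assms by (simp add: cover_addresses_Cons)
  show ?thesis
  proof (cases "e = 0")
    case True
    then show ?thesis
      using x nbr_wired_cover_parent(2)[of "Suc h" "k # x" G \<chi> i]
        nbr_wired_cover_parent(2)[of h x G \<chi> "\<chi> i k"] by simp
  next
    case False
    then have "e \<in> {1..outdeg G (vertex_type \<chi> (\<chi> i k) x)}" using assms x by auto
    then show ?thesis
      using x False nbr_wired_cover_child[OF kx, of e "Suc h"] nbr_wired_cover_child[OF x(2), of e h] by simp
  qed
qed

lemma branch_graft [simp]: "v \<noteq> Anc \<Longrightarrow> branch k \<rho> v = \<rho> (graft k v)"
  by (simp add: branch_def)

lemma replace_branch_self: "branch k \<rho> = \<tau> \<Longrightarrow> replace_branch k \<tau> \<rho> = \<rho>"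
proof
  fix v assume "branch k \<rho> = \<tau>"
  then show "replace_branch k \<tau> \<rho> v = \<rho> v"
    by (cases "(k, \<tau>, \<rho>, v)" rule: replace_branch.cases) auto
qed

lemma replace_branch_upd:
  "v \<noteq> Anc \<Longrightarrow> (replace_branch k \<sigma> \<rho>)(graft k v := e) = replace_branch k (\<sigma>(v := e)) \<rho>"
proof
  fix u assume "v \<noteq> Anc"
  then obtain x where "v = Node x" by (cases v) auto
  then show "((replace_branch k \<sigma> \<rho>)(graft k v := e)) u = replace_branch k (\<sigma>(v := e)) \<rho> u"
    by (cases "(k, \<sigma>, \<rho>, u)" rule: replace_branch.cases) auto
qed

lemma branch_replace_branch:
  assumes "\<sigma> Anc = undefined"
  shows "branch j (replace_branch k \<sigma> \<rho>) = (if j = k then \<sigma> else branch j \<rho>)"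
proof
  fix v show "branch j (replace_branch k \<sigma> \<rho>) v = (if j = k then \<sigma> else branch j \<rho>) v"
    using assms by (cases v) (auto simp: branch_def)
qed

lemma branch_root_upd [simp]: "branch k (\<rho>(Node [] := e)) = branch k \<rho>"
proof
  fix v show "branch k (\<rho>(Node [] := e)) v = branch k \<rho> v" by (cases v) (auto simp: branch_def)
qed

lemma Anc_not_inner [simp]: "Anc \<notin> inner (wired_cover G \<chi> h i)"
  by (simp add: wired_cover_def Let_def sink_down_def)

lemma rotor_configs_outside: "\<rho> \<in> rotor_configs g \<Longrightarrow> v \<notin> inner g \<Longrightarrow> \<rho> v = undefined"
  unfolding rotor_configs_def by (rule PiE_arb)

lemma rotor_configs_Anc: "\<sigma> \<in> rotor_configs (wired_cover G \<chi> h i) \<Longrightarrow> \<sigma> Anc = undefined"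
  by (simp add: rotor_configs_outside)

lemma rotor_less:
  "\<rho> \<in> rotor_configs (wired_cover G \<chi> h i) \<Longrightarrow> v \<in> inner (wired_cover G \<chi> h i) \<Longrightarrow>
    \<rho> v < cover_deg G \<chi> i v"
  unfolding rotor_configs_def by auto

text \<open>
A configuration is determined by the rotor at the root and its branches.
\<close>

lemma rotor_config_eqI:
  assumes "0 < h" "\<rho> \<in> rotor_configs (wired_cover G \<chi> (Suc h) i)"
    "\<sigma> \<in> rotor_configs (wired_cover G \<chi> (Suc h) i)"
    "\<rho> (Node []) = \<sigma> (Node [])" "\<And>k. k \<in> {1..outdeg G i} \<Longrightarrow> branch k \<rho> = branch k \<sigma>"
  shows "\<rho> = \<sigma>"
proof -
  have "\<rho> v = \<sigma> v" if "v \<in> inner (wired_cover G \<chi> (Suc h) i)" for v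
  proof -
    have "v = Node [] \<or> (\<exists>k\<in>{1..outdeg G i}. \<exists>u\<in>inner (wired_cover G \<chi> h (\<chi> i k)). v = graft k u)"
      using that unfolding inner_wired_cover_Suc[OF assms(1)] insert_iff UN_iff image_iff .
    then show ?thesis
    proof (elim disjE bexE)
      fix k u
      assume 2: "k \<in> {1..outdeg G i}" "u \<in> inner (wired_cover G \<chi> h (\<chi> i k))" "v = graft k u"
      then have "u \<noteq> Anc" by auto
      then show ?thesis
        using 2 fun_cong[OF assms(5)[of k], of u] by simp
    qed (use assms in simp)
  qed
  then show ?thesis
    using assms(2,3) unfolding rotor_configs_def by (intro PiE_ext) auto
qed

lemma branch_rotor_configs:
  assumes "0 < h" "\<rho> \<in> rotor_configs (wired_cover G \<chi> (Suc h) i)" "k \<in> {1..outdeg G i}"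
  shows "branch k \<rho> \<in> rotor_configs (wired_cover G \<chi> h (\<chi> i k))"
  unfolding rotor_configs_def
proof (rule PiE_I)
  fix v assume v: "v \<in> inner (wired_cover G \<chi> h (\<chi> i k))"
  then have "v \<noteq> Anc" by auto
  then show "branch k \<rho> v \<in> {..<deg (wired_cover G \<chi> h (\<chi> i k)) v}"
    using graft_inner[OF assms(1,3) v] rotor_less[OF assms(2)] by (metis branch_graft deg_wired_cover lessThan_iff)
next
  fix v assume v: "v \<notin> inner (wired_cover G \<chi> h (\<chi> i k))"
  show "branch k \<rho> v = undefined"
  proof (cases v)
    case (Node x)
    then have "graft k v \<notin> inner (wired_cover G \<chi> (Suc h) i)"
      using v assms by (auto simp: inner_wired_cover cover_addresses_Cons)
    then show ?thesis using Node rotor_configs_outside[OF assms(2)] by simp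
  qed (simp add: branch_def)
qed

text \<open>
Any cycle of rotors in a branch avoids the sink of the branch and so is a cycle in the whole cover.
\<close>

lemma branch_recurrent:
  assumes "0 < h" "\<rho> \<in> recurrent_configs (wired_cover G \<chi> (Suc h) i)" "k \<in> {1..outdeg G i}"
  shows "branch k \<rho> \<in> recurrent_configs (wired_cover G \<chi> h (\<chi> i k))"
proof -
  let ?B = "wired_cover G \<chi> (Suc h) i" and ?W = "wired_cover G \<chi> h (\<chi> i k)"
  define r s where "r = {(Some v, nbr ?B v (\<rho> v)) | v. v \<in> inner ?B}"
    and "s = {(Some v, nbr ?W v (branch k \<rho> v)) | v. v \<in> inner ?W}"
  have \<rho>: "\<rho> \<in> rotor_configs ?B" and r: "acyclic r"
    using assms(2) by (simp_all add: recurrent_configs_def r_def)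
  note b = branch_rotor_configs[OF assms(1) \<rho> assms(3)]
  have edge: "b \<noteq> None \<longrightarrow> (map_option (graft k) a, map_option (graft k) b) \<in> r" if ab: "(a, b) \<in> s" for a b
  proof -
    from ab obtain v where v: "a = Some v" "b = nbr ?W v (branch k \<rho> v)" "v \<in> inner ?W"
      by (auto simp: s_def)
    then have "v \<noteq> Anc" by auto
    have less: "branch k \<rho> v < cover_deg G \<chi> (\<chi> i k) v"
      using rotor_less[OF b] v by simp
    note n = nbr_graft[OF assms(1,3) v(3) less]
    have "b = None" if "v = Node [] \<and> branch k \<rho> v = 0"
      using that v nbr_wired_cover_parent(1)[OF assms(1), of G \<chi> "\<chi> i k"] by (auto simp del: branch_graft)
    then show ?thesis
      using n graft_inner[OF assms(1,3) v(3)] v \<open>v \<noteq> Anc\<close> by (auto simp: r_def)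
  qed
  have "b \<noteq> None \<longrightarrow> (map_option (graft k) a, map_option (graft k) b) \<in> r\<^sup>+" if "(a, b) \<in> s\<^sup>+" for a b
    using that
  proof induction
    case (base b)
    then show ?case using edge by blast
  next
    case (step b c)
    from step(2) have "b \<noteq> None" by (auto simp: s_def)
    then show ?case
      using step(3) edge[OF step(2)] by (auto intro: trancl_into_trancl)
  qed
  moreover have "a \<noteq> None" if "(a, b) \<in> s\<^sup>+" for a b
    using that by (induction) (auto simp: s_def)
  ultimately have "acyclic s" using r unfolding acyclic_def by blast
  then show ?thesis using b by (simp add: recurrent_configs_def s_def)
qed

text \<open>
Otherwise the rotors at the root and at its child form a cycle of length two.
\<close>

lemma recurrent_child_rotor_up:
  assumes "0 < h" "\<rho> \<in> recurrent_configs (wired_cover G \<chi> (Suc h) i)"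
    and "\<rho> (Node []) = k" "k \<noteq> 0"
  shows "\<rho> (Node [k]) \<noteq> 0"
proof
  let ?B = "wired_cover G \<chi> (Suc h) i"
  define r where "r = {(Some v, nbr ?B v (\<rho> v)) | v. v \<in> inner ?B}"
  assume 0: "\<rho> (Node [k]) = 0"
  have "\<rho> (Node []) < Suc (outdeg G i)"
    using assms(2) rotor_less[of \<rho> G \<chi> "Suc h" i, OF _ root_inner]
    by (simp add: recurrent_configs_def vertex_type_def)
  then have k: "k \<in> {1..outdeg G i}" using assms by auto
  then have "nbr ?B (Node []) k = Some (Node [k])"
    using nbr_wired_cover_child[OF cover_addresses.root, of k G \<chi> i "Suc h"] assms(1)
    by (simp add: vertex_type_def)
  then have "(Some (Node []), Some (Node [k])) \<in> r"
    using root_inner[of "Suc h" G \<chi> i] assms(3) unfolding r_def by force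
  moreover have "Node [k] \<in> inner ?B"
    using k assms(1) by (simp add: inner_wired_cover cover_addresses_Cons cover_addresses.root)
  then have "(Some (Node [k]), Some (Node [])) \<in> r"
    using 0 nbr_wired_cover_parent(2)[of "Suc h" "[k]" G \<chi> i] assms(1) unfolding r_def by force
  ultimately have "(Some (Node []), Some (Node [])) \<in> r\<^sup>+"
    by (meson r_into_trancl trancl_into_trancl)
  then show False using assms(2) by (auto simp: recurrent_configs_def acyclic_def r_def)
qed

section \<open>The walk seen from the root\<close>

text \<open>
The walk in a branch, observed in the whole cover: stopping down in the branch means being at the root
again.
\<close>

lemma rotor_step_graft:
  assumes "0 < h" "k \<in> {1..outdeg G i}"
    and \<sigma>: "\<sigma> \<in> rotor_configs (wired_cover G \<chi> h (\<chi> i k))" and w: "w \<in> inner (wired_cover G \<chi> h (\<chi> i k))"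
    and step: "rotor_step (wired_cover G \<chi> h (\<chi> i k)) (\<sigma>, Some w) = (\<sigma>', p)"
  shows "rotor_step (wired_cover G \<chi> (Suc h) i) (replace_branch k \<sigma> \<rho>, Some (graft k w)) =
    (replace_branch k \<sigma>' \<rho>, if w = Node [] \<and> \<sigma>' w = 0 then Some (Node []) else map_option (graft k) p)"
proof -
  let ?W = "wired_cover G \<chi> h (\<chi> i k)"
  interpret W: finite_sink_graph ?W using assms(1) by (rule finite_sink_graph_wired_cover)
  obtain x where x: "w = Node x" using w by (cases w) auto
  define e where "e = Suc (\<sigma> w) mod cover_deg G \<chi> (\<chi> i k) w"
  have eq: "\<sigma>' = \<sigma>(w := e)" "p = nbr ?W w e"
    using W.rotor_step_inner(1)[OF \<sigma> w] step by (auto simp: e_def)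
  have e: "e < cover_deg G \<chi> (\<chi> i k) w" unfolding e_def x by (intro mod_less_divisor) simp
  have "replace_branch k \<sigma> \<rho> (graft k w) = \<sigma> w" using x by simp
  then have "rotor_step (wired_cover G \<chi> (Suc h) i) (replace_branch k \<sigma> \<rho>, Some (graft k w)) =
      ((replace_branch k \<sigma> \<rho>)(graft k w := e), nbr (wired_cover G \<chi> (Suc h) i) (graft k w) e)"
    using graft_inner(2)[OF assms(1,2) w] by (simp add: e_def Let_def)
  also have "(replace_branch k \<sigma> \<rho>)(graft k w := e) = replace_branch k \<sigma>' \<rho>"
    unfolding eq(1) by (rule replace_branch_upd) (simp add: x)
  finally show ?thesis
    unfolding nbr_graft[OF assms(1,2) w e] using eq by simp
qed

lemma rotor_walk_graft:
  assumes "0 < h" "k \<in> {1..outdeg G i}"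
    and \<rho>: "branch k \<rho> \<in> rotor_configs (wired_cover G \<chi> h (\<chi> i k))"
    and v: "v \<in> inner (wired_cover G \<chi> h (\<chi> i k))"
    and "rotor_walk (wired_cover G \<chi> h (\<chi> i k)) v (branch k \<rho>) n = (\<sigma>, Some w)"
  shows "(rotor_step (wired_cover G \<chi> (Suc h) i) ^^ n) (\<rho>, Some (graft k v)) = (replace_branch k \<sigma> \<rho>, Some (graft k w))
    \<and> \<sigma> \<in> rotor_configs (wired_cover G \<chi> h (\<chi> i k)) \<and> w \<in> inner (wired_cover G \<chi> h (\<chi> i k))"
  using assms(5)
proof (induction n arbitrary: \<sigma> w)
  case 0
  then show ?case using \<rho> v by (auto simp: rotor_walk_def replace_branch_self)
next
  case (Suc n)
  let ?W = "wired_cover G \<chi> h (\<chi> i k)" and ?B = "wired_cover G \<chi> (Suc h) i"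
  interpret W: finite_sink_graph ?W using assms(1) by (rule finite_sink_graph_wired_cover)
  obtain \<tau> p where tp: "rotor_walk ?W v (branch k \<rho>) n = (\<tau>, p)" by fastforce
  then have step: "rotor_step ?W (\<tau>, p) = (\<sigma>, Some w)" using Suc.prems by (simp add: rotor_walk_def)
  then obtain u where p: "p = Some u" by (cases p) auto
  have IH: "(rotor_step ?B ^^ n) (\<rho>, Some (graft k v)) = (replace_branch k \<tau> \<rho>, Some (graft k u))"
    and \<tau>: "\<tau> \<in> rotor_configs ?W" and u: "u \<in> inner ?W"
    using Suc.IH tp p by auto
  have eq: "\<sigma> = \<tau>(u := Suc (\<tau> u) mod deg ?W u)" "nbr ?W u (\<sigma> u) = Some w"
    using step p by (auto simp: Let_def simp del: deg_wired_cover)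
  have "\<sigma> \<in> rotor_configs ?W" "Some w \<in> insert None (Some ` inner ?W)"
    using W.rotor_step_inner[OF \<tau> u] step p by (auto simp: W.vertices_def)
  moreover have "\<not> (u = Node [] \<and> \<sigma> u = 0)"
    using eq(2) nbr_wired_cover_parent(1)[OF assms(1), of G \<chi> "\<chi> i k"] by (metis option.distinct(1))
  ultimately show ?case
    using IH rotor_step_graft[OF assms(1,2) \<tau> u, of \<sigma> "Some w" \<rho>] step p by auto
qed

text \<open>
Whether the last particle stopped down or up can be read off from the final rotor at the root: if it
points down, then the rotor path from the root goes straight to the sink, and the last vertex of the
walk, which lies on this path, is the root.
\<close>

lemma last_edge_wired_cover:
  assumes "0 < h" "\<rho> \<in> recurrent_configs (wired_cover G \<chi> h i)"
    and "last_edge (wired_cover G \<chi> h i) (Node []) \<rho> = (w, e)"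
  shows "w = Node [] \<and> e = 0 \<longleftrightarrow> route (wired_cover G \<chi> h i) (Node []) \<rho> (Node []) = 0"
    "cover_nbr w e \<in> sink_down \<longleftrightarrow> route (wired_cover G \<chi> h i) (Node []) \<rho> (Node []) = 0"
    "cover_nbr w e \<in> sink_up G \<chi> h i \<longleftrightarrow> route (wired_cover G \<chi> h i) (Node []) \<rho> (Node []) \<noteq> 0"
proof -
  let ?g = "wired_cover G \<chi> h i"
  interpret finite_sink_graph ?g using assms(1) by (rule finite_sink_graph_wired_cover)
  define \<sigma> where "\<sigma> = route ?g (Node []) \<rho>"
  obtain n where we: "e = \<sigma> w" "w \<in> inner ?g" "nbr ?g w e = None"
    "(rotor_target (Node []) \<sigma> ^^ n) (Some (Node [])) = Some w"
    using last_edge_on_rotor_path[OF root_inner[OF assms(1)] assms(2)] assms(3) unfolding \<sigma>_def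
    by (metis prod.inject)
  have "w = Node []" if "\<sigma> (Node []) = 0"
  proof -
    have "(rotor_target (Node []) \<sigma> ^^ m) (Some (Node [])) \<in> {Some (Node []), None}" for m
      by (induction m) (use that nbr_wired_cover_parent(1)[OF assms(1), of G \<chi> i] in auto)
    then show ?thesis using we(4) by (metis empty_iff insert_iff option.distinct(1) option.inject)
  qed
  then show down: "w = Node [] \<and> e = 0 \<longleftrightarrow> route ?g (Node []) \<rho> (Node []) = 0"
    using we(1) unfolding \<sigma>_def by auto
  obtain x where x: "w = Node x" using we(2) by (cases w) auto
  have Anc: "cover_nbr w e = Anc \<longleftrightarrow> w = Node [] \<and> e = 0"
    unfolding x by (cases e) auto
  then show d: "cover_nbr w e \<in> sink_down \<longleftrightarrow> route ?g (Node []) \<rho> (Node []) = 0"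
    using down by (simp add: sink_down_def)
  have "cover_nbr w e \<in> sink_down \<union> sink_up G \<chi> h i"
    using we(3) by (auto simp: wired_cover_def Let_def contract_def split: if_splits)
  moreover have "sink_down \<inter> sink_up G \<chi> h i = {}"
    by (auto simp: sink_down_def sink_up_def)
  ultimately show "cover_nbr w e \<in> sink_up G \<chi> h i \<longleftrightarrow> route ?g (Node []) \<rho> (Node []) \<noteq> 0"
    unfolding d[symmetric] by (metis Un_iff disjoint_iff)
qed

text \<open>
The effect of one turn of the walk on the configuration: the rotor at the root advances and, unless it
points down, the particle passes through the branch that it points to, either back to the root or to
the upper sink.
\<close>

definition root_turn ::
    "('a, 'e) pre_digraph \<Rightarrow> ('a \<Rightarrow> nat \<Rightarrow> 'a) \<Rightarrow> nat \<Rightarrow> 'a \<Rightarrow> (cover_vertex \<Rightarrow> nat) \<Rightarrow> cover_vertex \<Rightarrow> nat" where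
  "root_turn G \<chi> h i \<rho> =
     (let k = Suc (\<rho> (Node [])) mod Suc (outdeg G i); \<rho>' = \<rho>(Node [] := k)
      in if k = 0 then \<rho>'
         else replace_branch k (route (wired_cover G \<chi> h (\<chi> i k)) (Node []) (branch k \<rho>)) \<rho>')"

text \<open>
The configurations after which a turn has stopped the particle: the particle was last seen at the root
going down, or it entered a branch and did not leave it downwards.
\<close>

definition stopping_configs :: "(cover_vertex \<Rightarrow> nat) set" where
  "stopping_configs = {\<rho>. \<rho> (Node []) = 0 \<or> \<rho> (Node [\<rho> (Node [])]) \<noteq> 0}"

text \<open>
The domain on which turns are iterated. It is larger than the set of recurrent configurations, since a
particle waiting at the root may leave a rotor cycle between the root and a child.
\<close>

definition branchwise_recurrent ::
    "('a, 'e) pre_digraph \<Rightarrow> ('a \<Rightarrow> nat \<Rightarrow> 'a) \<Rightarrow> nat \<Rightarrow> 'a \<Rightarrow> (cover_vertex \<Rightarrow> nat) set" where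
  "branchwise_recurrent G \<chi> h i = {\<rho> \<in> rotor_configs (wired_cover G \<chi> (Suc h) i).
     \<forall>k\<in>{1..outdeg G i}. branch k \<rho> \<in> recurrent_configs (wired_cover G \<chi> h (\<chi> i k))}"

lemma recurrent_imp_branchwise:
  assumes "0 < h" "\<rho> \<in> recurrent_configs (wired_cover G \<chi> (Suc h) i)"
  shows "\<rho> \<in> branchwise_recurrent G \<chi> h i"
proof -
  have "\<rho> \<in> rotor_configs (wired_cover G \<chi> (Suc h) i)"
    using assms(2) by (simp add: recurrent_configs_def)
  then show ?thesis
    unfolding branchwise_recurrent_def using branch_recurrent[OF assms] by blast
qed

lemma recurrent_imp_stopping:
  assumes "0 < h" "\<rho> \<in> recurrent_configs (wired_cover G \<chi> (Suc h) i)"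
  shows "\<rho> \<in> stopping_configs"
  unfolding stopping_configs_def using recurrent_child_rotor_up[OF assms refl] by blast

lemma root_turn_root: "root_turn G \<chi> h i \<rho> (Node []) = Suc (\<rho> (Node [])) mod Suc (outdeg G i)"
  by (simp add: root_turn_def Let_def)

lemma branch_root_turn:
  assumes "0 < h" "\<rho> \<in> branchwise_recurrent G \<chi> h i" "j \<in> {1..outdeg G i}"
  shows "branch j (root_turn G \<chi> h i \<rho>) =
    (if j = Suc (\<rho> (Node [])) mod Suc (outdeg G i)
     then route (wired_cover G \<chi> h (\<chi> i j)) (Node []) (branch j \<rho>) else branch j \<rho>)"
proof -
  define k where "k = Suc (\<rho> (Node [])) mod Suc (outdeg G i)"
  show ?thesis
  proof (cases "k = 0")
    case True
    then show ?thesis using assms(3) by (simp add: root_turn_def Let_def k_def)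
  next
    case False
    have "k < Suc (outdeg G i)" unfolding k_def by (rule mod_less_divisor) simp
    then have k: "k \<in> {1..outdeg G i}" using False by simp
    interpret W: finite_sink_graph "wired_cover G \<chi> h (\<chi> i k)"
      using assms(1) by (rule finite_sink_graph_wired_cover)
    have "route (wired_cover G \<chi> h (\<chi> i k)) (Node []) (branch k \<rho>) Anc = undefined"
      using W.route_recurrent[OF root_inner[OF assms(1)], of "branch k \<rho>"] assms(2) k
      by (intro rotor_configs_Anc) (auto simp: branchwise_recurrent_def recurrent_configs_def)
    then show ?thesis
      using False by (simp add: root_turn_def Let_def k_def[symmetric] branch_replace_branch)
  qed
qed

lemma root_turn_walk:
  assumes "0 < h" "\<rho> \<in> branchwise_recurrent G \<chi> h i"
  shows "\<exists>n. (rotor_step (wired_cover G \<chi> (Suc h) i) ^^ n) (\<rho>, Some (Node [])) =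
    (root_turn G \<chi> h i \<rho>, if root_turn G \<chi> h i \<rho> \<in> stopping_configs then None else Some (Node []))"
proof -
  let ?B = "wired_cover G \<chi> (Suc h) i"
  define k where "k = Suc (\<rho> (Node [])) mod Suc (outdeg G i)"
  define \<rho>' where "\<rho>' = \<rho>(Node [] := k)"
  have first: "rotor_step ?B (\<rho>, Some (Node [])) = (\<rho>', nbr ?B (Node []) k)"
    by (simp add: Let_def k_def \<rho>'_def vertex_type_def)
  show ?thesis
  proof (cases "k = 0")
    case True
    then have "(rotor_step ?B ^^ 1) (\<rho>, Some (Node [])) = (root_turn G \<chi> h i \<rho>, None)"
      using first nbr_wired_cover_parent(1)[of "Suc h" G \<chi> i]
      by (simp add: root_turn_def k_def[symmetric] \<rho>'_def del: rotor_step.simps)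
    moreover have "root_turn G \<chi> h i \<rho> \<in> stopping_configs"
      using True root_turn_root[of G \<chi> h i \<rho>] by (simp add: stopping_configs_def k_def)
    ultimately show ?thesis by (intro exI[of _ 1]) simp
  next
    case False
    let ?W = "wired_cover G \<chi> h (\<chi> i k)"
    have "k < Suc (outdeg G i)" unfolding k_def by (rule mod_less_divisor) simp
    then have k: "k \<in> {1..outdeg G i}" using False by simp
    interpret W: finite_sink_graph ?W using assms(1) by (rule finite_sink_graph_wired_cover)
    have rec: "branch k \<rho>' \<in> recurrent_configs ?W"
      using assms(2) k by (simp add: branchwise_recurrent_def \<rho>'_def)
    note root = root_inner[OF assms(1), of G \<chi> "\<chi> i k"]
    define \<sigma> where "\<sigma> = route ?W (Node []) (branch k \<rho>')"
    obtain n \<tau> w where w: "rotor_walk ?W (Node []) (branch k \<rho>') n = (\<tau>, Some w)"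
      "rotor_step ?W (\<tau>, Some w) = (\<sigma>, None)"
      "last_edge ?W (Node []) (branch k \<rho>') = (w, \<sigma> w)"
      using W.first_return_to_sink[OF root rec] unfolding \<sigma>_def by metis
    have rc: "branch k \<rho>' \<in> rotor_configs ?W" using rec by (simp add: recurrent_configs_def)
    note inside = rotor_walk_graft[OF assms(1) k rc root w(1)]
    have "nbr ?B (Node []) k = Some (graft k (Node []))"
      using nbr_wired_cover_child[OF cover_addresses.root, of k G \<chi> i "Suc h"] k assms(1)
      by (simp add: vertex_type_def)
    then have first': "rotor_step ?B (\<rho>, Some (Node [])) = (\<rho>', Some (graft k (Node [])))"
      using first by metis
    have M: "root_turn G \<chi> h i \<rho> = replace_branch k \<sigma> \<rho>'"
      using False by (simp add: root_turn_def Let_def k_def[symmetric] \<sigma>_def \<rho>'_def)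
    have "(rotor_step ?B ^^ Suc (Suc n)) (\<rho>, Some (Node [])) =
      rotor_step ?B ((rotor_step ?B ^^ n) (rotor_step ?B (\<rho>, Some (Node []))))"
      by (simp add: funpow_swap1 del: rotor_step.simps)
    also have "\<dots> = rotor_step ?B (replace_branch k \<tau> \<rho>', Some (graft k w))"
      unfolding first' using inside by metis
    also have "\<dots> = (replace_branch k \<sigma> \<rho>', if w = Node [] \<and> \<sigma> w = 0 then Some (Node []) else None)"
      using rotor_step_graft[OF assms(1) k _ _ w(2)] inside by simp
    also have "\<dots> = (root_turn G \<chi> h i \<rho>, if root_turn G \<chi> h i \<rho> \<in> stopping_configs then None else Some (Node []))"
      using last_edge_wired_cover(1)[OF assms(1) rec w(3)] False
      unfolding M by (auto simp: stopping_configs_def \<rho>'_def \<sigma>_def)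
    finally show ?thesis by blast
  qed
qed

lemma root_turn_branchwise_recurrent:
  assumes "0 < h" "\<rho> \<in> branchwise_recurrent G \<chi> h i"
  shows "root_turn G \<chi> h i \<rho> \<in> branchwise_recurrent G \<chi> h i"
proof -
  interpret B: finite_sink_graph "wired_cover G \<chi> (Suc h) i"
    by (rule finite_sink_graph_wired_cover) simp
  obtain n p where "(rotor_step (wired_cover G \<chi> (Suc h) i) ^^ n) (\<rho>, Some (Node [])) = (root_turn G \<chi> h i \<rho>, p)"
    using root_turn_walk[OF assms] by blast
  then have "root_turn G \<chi> h i \<rho> \<in> rotor_configs (wired_cover G \<chi> (Suc h) i)"
    using B.rotor_walk_closed[of \<rho> "Node []" n] assms(2) root_inner[of "Suc h" G \<chi> i]
    by (simp add: branchwise_recurrent_def rotor_walk_def)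
  moreover have "branch k (root_turn G \<chi> h i \<rho>) \<in> recurrent_configs (wired_cover G \<chi> h (\<chi> i k))"
    if k: "k \<in> {1..outdeg G i}" for k
  proof -
    interpret W: finite_sink_graph "wired_cover G \<chi> h (\<chi> i k)"
      using assms(1) by (rule finite_sink_graph_wired_cover)
    have b: "branch k \<rho> \<in> recurrent_configs (wired_cover G \<chi> h (\<chi> i k))"
      using assms(2) k by (simp add: branchwise_recurrent_def)
    show ?thesis
      unfolding branch_root_turn[OF assms k]
      using W.route_recurrent[OF root_inner[OF assms(1)] b] b by metis
  qed
  ultimately show ?thesis by (simp add: branchwise_recurrent_def)
qed

text \<open>
The odometer: the rotor at the root moves with constant speed, and a branch has been changed as often
as this rotor has moved to it.
\<close>

lemma root_turn_funpow:
  assumes "0 < h" "\<rho> \<in> branchwise_recurrent G \<chi> h i"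
  defines "q \<equiv> Suc (outdeg G i)" and "a \<equiv> \<rho> (Node [])"
  shows "(root_turn G \<chi> h i ^^ t) \<rho> \<in> branchwise_recurrent G \<chi> h i"
    and "(root_turn G \<chi> h i ^^ t) \<rho> (Node []) = (a + t) mod q"
    and "k \<in> {1..outdeg G i} \<Longrightarrow> branch k ((root_turn G \<chi> h i ^^ t) \<rho>) =
      (route (wired_cover G \<chi> h (\<chi> i k)) (Node []) ^^ ((a + q - k + t) div q - (a + q - k) div q)) (branch k \<rho>)"
proof -
  let ?M = "root_turn G \<chi> h i"
  have "?M ` branchwise_recurrent G \<chi> h i \<subseteq> branchwise_recurrent G \<chi> h i"
    by (rule image_subsetI) (rule root_turn_branchwise_recurrent[OF assms(1)])
  from funpow_in[OF this assms(2)]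
  show closed: "(?M ^^ t) \<rho> \<in> branchwise_recurrent G \<chi> h i" for t .
  have "a < q"
    using assms(2) rotor_less[of \<rho> G \<chi> "Suc h" i, OF _ root_inner]
    by (simp add: branchwise_recurrent_def a_def q_def vertex_type_def)
  show root: "(?M ^^ t) \<rho> (Node []) = (a + t) mod q" for t
  proof (induction t)
    case (Suc t)
    then show ?case by (simp add: root_turn_root q_def[symmetric] mod_Suc_eq)
  qed (use \<open>a < q\<close> in \<open>simp add: a_def\<close>)
  assume k: "k \<in> {1..outdeg G i}"
  then have "k < q" by (simp add: q_def)
  let ?E = "route (wired_cover G \<chi> h (\<chi> i k)) (Node [])"
  show "branch k ((?M ^^ t) \<rho>) = (?E ^^ ((a + q - k + t) div q - (a + q - k) div q)) (branch k \<rho>)"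
  proof (induction t)
    case (Suc t)
    \<comment> \<open>The rotor moves to \<open>k\<close> exactly when the quotient in the exponent increases.\<close>
    have hit: "k = Suc ((a + t) mod q) mod q \<longleftrightarrow> Suc (a + q - k + t) mod q = 0"
    proof -
      have "Suc (a + q - k + t) + k = Suc (a + t) + q" using \<open>k < q\<close> by simp
      then have "(Suc (a + q - k + t) + k) mod q = Suc (a + t) mod q" by (simp only: mod_add_self2)
      moreover have "(Suc (a + q - k + t) + k) mod q = k mod q \<longleftrightarrow> Suc (a + q - k + t) mod q = 0 mod q"
        unfolding nat_mod_eq_iff by (auto simp: algebra_simps)
      ultimately show ?thesis using \<open>k < q\<close> by (auto simp: mod_Suc_eq)
    qed
    have "(a + q - k) div q \<le> (a + q - k + t) div q" by (rule div_le_mono) simp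
    then show ?case
      using branch_root_turn[OF assms(1) closed k, of t] Suc hit
      unfolding root q_def[symmetric] by (simp add: div_Suc Suc_diff_le)
  qed simp
qed

text \<open>
A particle that has not stopped after a turn is back at the root, so it makes the next turn; it stops
at the first turn that ends in a stopping configuration.
\<close>

lemma route_first_return:
  assumes "0 < h" "\<rho> \<in> branchwise_recurrent G \<chi> h i"
    and "0 < t" "(root_turn G \<chi> h i ^^ t) \<rho> \<in> stopping_configs"
  shows "\<exists>\<tau>>0. route (wired_cover G \<chi> (Suc h) i) (Node []) \<rho> = (root_turn G \<chi> h i ^^ \<tau>) \<rho> \<and>
    (\<forall>s. 0 < s \<and> s < \<tau> \<longrightarrow> (root_turn G \<chi> h i ^^ s) \<rho> \<notin> stopping_configs)"
proof -
  let ?B = "wired_cover G \<chi> (Suc h) i" and ?M = "root_turn G \<chi> h i"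
  interpret B: finite_sink_graph ?B by (rule finite_sink_graph_wired_cover) simp
  define P where "P t \<longleftrightarrow> 0 < t \<and> (?M ^^ t) \<rho> \<in> stopping_configs" for t
  define \<tau> where "\<tau> = (LEAST t. P t)"
  have "P \<tau>" unfolding \<tau>_def using assms(3,4) by (intro LeastI[of P t]) (simp add: P_def)
  have before: "(?M ^^ s) \<rho> \<notin> stopping_configs" if "0 < s" "s < \<tau>" for s
    using not_less_Least[of s P] that unfolding \<tau>_def[symmetric] by (simp add: P_def)
  have walk: "\<exists>n. (rotor_step ?B ^^ n) (\<rho>, Some (Node [])) = ((?M ^^ s) \<rho>, Some (Node []))" if "s < \<tau>" for s
    using that
  proof (induction s)
    case 0
    show ?case by (rule exI[of _ 0]) simp
  next
    case (Suc s)
    then obtain n where n: "(rotor_step ?B ^^ n) (\<rho>, Some (Node [])) = ((?M ^^ s) \<rho>, Some (Node []))" by auto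
    obtain m where m: "(rotor_step ?B ^^ m) ((?M ^^ s) \<rho>, Some (Node [])) = ((?M ^^ Suc s) \<rho>, Some (Node []))"
      using root_turn_walk[OF assms(1) root_turn_funpow(1)[OF assms(1,2)], of s] before[of "Suc s"] Suc.prems by auto
    have "(rotor_step ?B ^^ (m + n)) (\<rho>, Some (Node [])) = ((?M ^^ Suc s) \<rho>, Some (Node []))"
      using n m by (simp only: funpow_add o_apply)
    then show ?case by blast
  qed
  obtain s where s: "\<tau> = Suc s" using \<open>P \<tau>\<close> by (cases \<tau>) (auto simp: P_def)
  obtain n where n: "(rotor_step ?B ^^ n) (\<rho>, Some (Node [])) = ((?M ^^ s) \<rho>, Some (Node []))"
    using walk[of s] s by auto
  obtain m where m: "(rotor_step ?B ^^ m) ((?M ^^ s) \<rho>, Some (Node [])) = ((?M ^^ \<tau>) \<rho>, None)"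
    using root_turn_walk[OF assms(1) root_turn_funpow(1)[OF assms(1,2)], of s] \<open>P \<tau>\<close> s
    by (auto simp: P_def)
  have "rotor_walk ?B (Node []) \<rho> (m + n) = ((?M ^^ \<tau>) \<rho>, None)"
    unfolding rotor_walk_def using n m by (simp only: funpow_add o_apply)
  then have "route ?B (Node []) \<rho> = (?M ^^ \<tau>) \<rho>" by (rule B.route_eqI)
  then show ?thesis using \<open>P \<tau>\<close> before by (auto simp: P_def)
qed

section \<open>The order of the root element\<close>

text \<open>
The statement that is proved by induction over the height. At every recurrent configuration, the exact
period of routing a particle from the root is \<open>R\<close>, and \<open>U\<close> of the configurations in the orbit have
their root rotor pointing up. As the final rotor at the root tells where a particle stopped, \<open>U\<close> is the
number of particles stopped up.
\<close>

definition root_cycle ::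
    "('a, 'e) pre_digraph \<Rightarrow> ('a \<Rightarrow> nat \<Rightarrow> 'a) \<Rightarrow> nat \<Rightarrow> 'a \<Rightarrow> nat \<Rightarrow> nat \<Rightarrow> bool" where
  "root_cycle G \<chi> h i R U \<longleftrightarrow> 0 < R \<and> (\<forall>\<rho> \<in> recurrent_configs (wired_cover G \<chi> h i).
     (\<forall>N. (route (wired_cover G \<chi> h i) (Node []) ^^ N) \<rho> = \<rho> \<longleftrightarrow> R dvd N) \<and>
     card {N. N < R \<and> (route (wired_cover G \<chi> h i) (Node []) ^^ N) \<rho> (Node []) \<noteq> 0} = U)"

lemma root_cycle_height_1: "root_cycle G \<chi> 1 i (Suc (outdeg G i)) (outdeg G i)"
proof -
  let ?g = "wired_cover G \<chi> 1 i" and ?q = "Suc (outdeg G i)"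
  let ?E = "route ?g (Node [])"
  interpret finite_sink_graph ?g by (rule finite_sink_graph_wired_cover) simp
  have None: "nbr ?g (Node []) k = None" if "k < ?q" for k
  proof (cases "k = 0")
    case False
    then show ?thesis
      using nbr_wired_cover_child[OF cover_addresses.root, of k G \<chi> i 1] that by (simp add: vertex_type_def)
  qed (use nbr_wired_cover_parent(1)[of 1 G \<chi> i] in simp)
  have "?E \<rho> = \<rho>(Node [] := Suc (\<rho> (Node [])) mod ?q)" for \<rho>
  proof (rule route_eqI)
    have "Suc (\<rho> (Node [])) mod ?q < ?q" by (rule mod_less_divisor) simp
    then show "rotor_walk ?g (Node []) \<rho> 1 = (\<rho>(Node [] := Suc (\<rho> (Node [])) mod ?q), None)"
      using None by (simp add: rotor_walk_def Let_def vertex_type_def)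
  qed
  then have pow: "(?E ^^ N) \<rho> = \<rho>(Node [] := (\<rho> (Node []) + N) mod ?q)"
    if "\<rho> (Node []) < ?q" for \<rho> N
    by (induction N) (use that in \<open>simp_all add: mod_Suc_eq\<close>)
  show ?thesis
    unfolding root_cycle_def
  proof (intro conjI ballI allI)
    fix \<rho> assume "\<rho> \<in> recurrent_configs ?g"
    then have a: "\<rho> (Node []) < ?q"
      using rotor_less[of \<rho> G \<chi> 1 i, OF _ root_inner] by (simp add: recurrent_configs_def vertex_type_def)
    note powN = pow[of \<rho>, OF a]
    show "(?E ^^ N) \<rho> = \<rho> \<longleftrightarrow> ?q dvd N" for N
    proof -
      have "(?E ^^ N) \<rho> = \<rho> \<longleftrightarrow> (\<rho> (Node []) + N) mod ?q = \<rho> (Node [])"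
        unfolding powN fun_upd_idem_iff by (rule eq_commute)
      also have "\<dots> \<longleftrightarrow> (\<rho> (Node []) + N) mod ?q = (\<rho> (Node []) + 0) mod ?q"
        using a by simp
      also have "\<dots> \<longleftrightarrow> N mod ?q = 0 mod ?q"
        by (rule add_mod_left_cancel)
      finally show ?thesis by (simp add: dvd_eq_mod_eq_0)
    qed
    have "card {t. t < ?q \<and> (\<rho> (Node []) + t) mod ?q = 0} = 1"
      using card_residue_visits[OF a, of 0 1 "\<lambda>_. True"] by simp
    moreover have "{N. N < ?q \<and> (\<rho> (Node []) + N) mod ?q \<noteq> 0} =
      {..<?q} - {t. t < ?q \<and> (\<rho> (Node []) + t) mod ?q = 0}" by auto
    moreover have "card ({..<?q} - {t. t < ?q \<and> (\<rho> (Node []) + t) mod ?q = 0}) =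
      card {..<?q} - card {t. t < ?q \<and> (\<rho> (Node []) + t) mod ?q = 0}"
      by (rule card_Diff_subset) auto
    ultimately show "card {N. N < ?q \<and> (?E ^^ N) \<rho> (Node []) \<noteq> 0} = outdeg G i"
      unfolding powN by simp
  qed simp
qed

lemma root_turn_period:
  assumes "0 < h" "\<rho> \<in> branchwise_recurrent G \<chi> h i"
    and "\<And>k N. k \<in> {1..outdeg G i} \<Longrightarrow>
      (route (wired_cover G \<chi> h (\<chi> i k)) (Node []) ^^ N) (branch k \<rho>) = branch k \<rho> \<longleftrightarrow> R k dvd N"
  shows "(root_turn G \<chi> h i ^^ t) \<rho> = \<rho> \<longleftrightarrow> Lcm (R ` {1..outdeg G i}) * Suc (outdeg G i) dvd t"
proof -
  define q where "q = Suc (outdeg G i)"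
  define a where "a = \<rho> (Node [])"
  note M = root_turn_funpow[OF assms(1,2), folded q_def a_def]
  have "0 < q" by (simp add: q_def)
  have "a < q"
    using assms(2) rotor_less[of \<rho> G \<chi> "Suc h" i, OF _ root_inner]
    by (simp add: branchwise_recurrent_def a_def q_def vertex_type_def)
  have root: "(a + t) mod q = a \<longleftrightarrow> q dvd t"
  proof -
    have "(a + t) mod q = (a + 0) mod q \<longleftrightarrow> t mod q = 0 mod q"
      by (rule add_mod_left_cancel)
    then show ?thesis using \<open>a < q\<close> by (simp add: dvd_eq_mod_eq_0)
  qed
  have "(root_turn G \<chi> h i ^^ t) \<rho> = \<rho> \<longleftrightarrow> (root_turn G \<chi> h i ^^ t) \<rho> (Node []) = a \<and>
     (\<forall>k\<in>{1..outdeg G i}. branch k ((root_turn G \<chi> h i ^^ t) \<rho>) = branch k \<rho>)"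
    using rotor_config_eqI[OF assms(1), of "(root_turn G \<chi> h i ^^ t) \<rho>" G \<chi> i \<rho>] M(1)[of t] assms(2)
    by (auto simp: branchwise_recurrent_def a_def)
  also have "\<dots> \<longleftrightarrow> q dvd t \<and> (\<forall>k\<in>{1..outdeg G i}. R k dvd t div q)"
  proof (cases "q dvd t")
    case True
    then obtain n where n: "t = n * q" by (metis dvd_def mult.commute)
    have "(b + t) div q - b div q = t div q" for b
      using \<open>0 < q\<close> unfolding n by simp
    then show ?thesis using True M(2)[of t] root M(3)[of _ t] assms(3) by simp
  qed (use M(2)[of t] root in simp)
  also have "\<dots> \<longleftrightarrow> Lcm (R ` {1..outdeg G i}) * q dvd t"
  proof -
    have "Lcm (R ` {1..outdeg G i}) dvd n \<longleftrightarrow> (\<forall>k\<in>{1..outdeg G i}. R k dvd n)" for n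
      by (auto simp: Lcm_dvd_iff)
    then have "q dvd t \<and> (\<forall>k\<in>{1..outdeg G i}. R k dvd t div q) \<longleftrightarrow>
        q dvd t \<and> Lcm (R ` {1..outdeg G i}) dvd t div q" by simp
    also have "\<dots> \<longleftrightarrow> Lcm (R ` {1..outdeg G i}) * q dvd t"
    proof (cases "q dvd t")
      case True
      then obtain n where n: "t = n * q" by (metis dvd_def mult.commute)
      show ?thesis using \<open>0 < q\<close> unfolding n by simp
    next
      case False
      then show ?thesis using dvd_mult_right by blast
    qed
    finally show ?thesis .
  qed
  finally show ?thesis by (simp add: q_def)
qed

text \<open>
By the odometer, one period of the turns consists of \<open>L\<close> rotations of the rotor at the root. It is a
stopping configuration each time this rotor points down, \<open>L\<close> times, and each time it points to a child
\<open>k\<close> whose rotor then points up, which is \<open>L div R k\<close> times the number \<open>U k\<close> for the branch.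
\<close>

lemma root_cycle_Suc:
  assumes "0 < h" and sub: "\<And>k. k \<in> {1..outdeg G i} \<Longrightarrow> root_cycle G \<chi> h (\<chi> i k) (R k) (U k)"
  defines "L \<equiv> Lcm (R ` {1..outdeg G i})"
  defines "V \<equiv> (\<Sum>k\<in>{1..outdeg G i}. L div R k * U k)"
  shows "root_cycle G \<chi> (Suc h) i (L + V) V"
proof -
  let ?B = "wired_cover G \<chi> (Suc h) i" and ?M = "root_turn G \<chi> h i" and ?d = "outdeg G i"
  let ?E = "route ?B (Node [])" and ?E' = "\<lambda>k. route (wired_cover G \<chi> h (\<chi> i k)) (Node [])"
  define q where "q = Suc ?d"
  interpret B: finite_sink_graph ?B by (rule finite_sink_graph_wired_cover) simp
  have Rpos: "0 < R k" if "k \<in> {1..?d}" for k using sub[OF that] by (simp add: root_cycle_def)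
  then have "0 \<notin> R ` {1..?d}" by fastforce
  then have L: "0 < L"
    unfolding L_def using Lcm_0_iff[of "R ` {1..?d}"] by (intro gr0I) auto
  have main: "0 < L + V \<and> (\<forall>N. (?E ^^ N) \<rho> = \<rho> \<longleftrightarrow> L + V dvd N) \<and>
      card {N. N < L + V \<and> (?E ^^ N) \<rho> (Node []) \<noteq> 0} = V"
    if \<rho>: "\<rho> \<in> recurrent_configs ?B" for \<rho>
  proof -
    have period: "(?M ^^ t) z = z \<longleftrightarrow> L * q dvd t" if "z \<in> recurrent_configs ?B" for z t
      unfolding L_def q_def
    proof (rule root_turn_period[OF assms(1) recurrent_imp_branchwise[OF assms(1) that]])
      fix k N assume k: "k \<in> {1..?d}"
      show "(?E' k ^^ N) (branch k z) = branch k z \<longleftrightarrow> R k dvd N"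
        using sub[OF k] branch_recurrent[OF assms(1) that k] by (simp add: root_cycle_def)
    qed
    have ret: "\<exists>\<tau>>0. ?E z = (?M ^^ \<tau>) z \<and> (\<forall>s. 0 < s \<and> s < \<tau> \<longrightarrow> (?M ^^ s) z \<notin> stopping_configs)"
      if z: "z \<in> recurrent_configs ?B" for z
    proof (rule route_first_return[OF assms(1) recurrent_imp_branchwise[OF assms(1) z]])
      show "0 < L * q" using L by (simp add: q_def)
      show "(?M ^^ (L * q)) z \<in> stopping_configs"
        using period[OF z, of "L * q"] recurrent_imp_stopping[OF assms(1) z] by simp
    qed
    have Lq: "0 < L * q" using L by (simp add: q_def)
    have closed: "?E z \<in> recurrent_configs ?B" if "z \<in> recurrent_configs ?B" for z
      using B.route_recurrent[OF root_inner that] by simp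
    have sub_stop: "recurrent_configs ?B \<subseteq> stopping_configs"
      by (rule subsetI) (rule recurrent_imp_stopping[OF assms(1)])
    note induced = induced_map_period[where M = ?M and E = ?E and x = \<rho>, OF Lq period[OF \<rho>] \<rho> closed sub_stop ret]
    define a where "a = \<rho> (Node [])"
    have X: "\<rho> \<in> branchwise_recurrent G \<chi> h i" by (rule recurrent_imp_branchwise[OF assms(1) \<rho>])
    note Mt = root_turn_funpow[OF assms(1) X, folded q_def a_def]
    have "a < q"
      using X rotor_less[of \<rho> G \<chi> "Suc h" i, OF _ root_inner]
      by (simp add: branchwise_recurrent_def a_def q_def vertex_type_def)
    \<comment> \<open>The times split according to the position of the root rotor: \<open>D\<close> when it points down, \<open>W k\<close> when
      it points to child \<open>k\<close> and the rotor there points up.\<close>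
    define D where "D = {t. t < L * q \<and> (a + t) mod q = 0}"
    define W where "W k = {t. t < L * q \<and> (a + t) mod q = k \<and> (?M ^^ t) \<rho> (Node [k]) \<noteq> 0}" for k
    have range: "(a + t) mod q \<le> ?d" for t
      using mod_less_divisor[of q "a + t"] by (simp add: q_def less_Suc_eq_le del: mod_less_divisor)
    have up: "{t. t < L * q \<and> (?M ^^ t) \<rho> \<in> stopping_configs \<and> (?M ^^ t) \<rho> (Node []) \<noteq> 0} = (\<Union>k\<in>{1..?d}. W k)"
      unfolding W_def stopping_configs_def using Mt(2) range by auto
    have all: "{t. t < L * q \<and> (?M ^^ t) \<rho> \<in> stopping_configs} = D \<union> (\<Union>k\<in>{1..?d}. W k)"
      unfolding W_def D_def stopping_configs_def using Mt(2) range by auto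
    have cardD: "card D = L"
      unfolding D_def using card_residue_visits[OF \<open>a < q\<close>, of 0 L "\<lambda>_. True"] by (simp add: q_def)
    have cardW: "card (W k) = L div R k * U k" if k: "k \<in> {1..?d}" for k
    proof -
      interpret W: finite_sink_graph "wired_cover G \<chi> h (\<chi> i k)"
        using assms(1) by (rule finite_sink_graph_wired_cover)
      have "k < q" using k by (simp add: q_def)
      define A where "A n \<longleftrightarrow> (?E' k ^^ n) (branch k \<rho>) (Node []) \<noteq> 0" for n
      \<comment> \<open>If the rotor at the root does not start at \<open>k\<close>, then branch \<open>k\<close> is first seen after one application
        of its map; \<open>z\<close> is the state of the branch at that time.\<close>
      define e :: nat where "e = (if a = k then 0 else 1)"
      define z where "z = (?E' k ^^ e) (branch k \<rho>)"
      have z: "z \<in> recurrent_configs (wired_cover G \<chi> h (\<chi> i k))"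
      proof -
        have "?E' k ` recurrent_configs (wired_cover G \<chi> h (\<chi> i k)) \<subseteq> recurrent_configs (wired_cover G \<chi> h (\<chi> i k))"
          by (rule image_subsetI) (rule W.route_recurrent[OF root_inner[OF assms(1)]])
        from funpow_in[OF this branch_recurrent[OF assms(1) \<rho> k]]
        show ?thesis unfolding z_def .
      qed
      then have zR: "(?E' k ^^ R k) z = z" and zU: "card {N. N < R k \<and> (?E' k ^^ N) z (Node []) \<noteq> 0} = U k"
        using sub[OF k] by (auto simp: root_cycle_def)
      have Mk: "(?M ^^ t) \<rho> (Node [k]) = branch k ((?M ^^ t) \<rho>) (Node [])" for t by simp
      have "card (W k) = card {t. t < L * q \<and> (a + t) mod q = k \<and> A ((a + q - k + t) div q - (a + q - k) div q)}"
        unfolding W_def Mk Mt(3)[OF k] A_def ..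
      also have "\<dots> = card {n. n < L \<and> A (n + e)}"
        unfolding e_def by (rule card_residue_visits[OF \<open>a < q\<close> \<open>k < q\<close>])
      also have "\<dots> = card {n. n < (L div R k) * R k \<and> (?E' k ^^ n) z (Node []) \<noteq> 0}"
      proof -
        have "R k dvd L" using k by (simp add: L_def)
        then show ?thesis by (simp add: A_def z_def funpow_add)
      qed
      also have "\<dots> = L div R k * card {n. n < R k \<and> (?E' k ^^ n) z (Node []) \<noteq> 0}"
        by (rule card_periodic) (simp add: funpow_add zR)
      finally show ?thesis using zU by simp
    qed
    have cardV: "card (\<Union>k\<in>{1..?d}. W k) = V"
      unfolding V_def using cardW by (subst card_UN_disjoint) (auto simp: W_def)
    have "D \<inter> (\<Union>k\<in>{1..?d}. W k) = {}" by (auto simp: D_def W_def)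
    then have "card (D \<union> (\<Union>k\<in>{1..?d}. W k)) = L + V"
      using cardD cardV by (subst card_Un_disjoint) (auto simp: D_def W_def)
    then have R: "card {t. t < L * q \<and> (?M ^^ t) \<rho> \<in> stopping_configs} = L + V" using all by simp
    show ?thesis
      using induced(1,2) induced(3)[of "\<lambda>z. z (Node []) \<noteq> 0"] up cardV unfolding R by simp
  qed
  then show ?thesis using L by (simp add: root_cycle_def)
qed

lemma root_cycle_exists: "0 < h \<Longrightarrow> \<exists>R U. root_cycle G \<chi> h i R U"
proof (induction h arbitrary: i)
  case (Suc h)
  show ?case
  proof (cases "h = 0")
    case True
    then show ?thesis using root_cycle_height_1[of G \<chi> i] by auto
  next
    case False
    then have "\<forall>j. \<exists>R U. root_cycle G \<chi> h j R U" using Suc.IH by simp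
    then obtain R U where RU: "\<And>j. root_cycle G \<chi> h j (R j) (U j)" by metis
    from root_cycle_Suc[of h G i \<chi> "\<lambda>k. R (\<chi> i k)" "\<lambda>k. U (\<chi> i k)", OF _ RU] False
    show ?thesis by blast
  qed
qed simp

text \<open>
Counting the configurations reached after each particle instead of those before it shifts the window
by one step along the orbit. The count is unchanged, as it is the same from every recurrent starting
configuration.
\<close>

lemma root_cycle_counts:
  assumes "0 < h" "\<rho> \<in> recurrent_configs (wired_cover G \<chi> h i)" and cyc: "root_cycle G \<chi> h i R U"
  shows "root_order G \<chi> h i = R" "stopped_up G \<chi> h i \<rho> = U" "stopped_down G \<chi> h i \<rho> + U = R"
proof -
  let ?g = "wired_cover G \<chi> h i"
  let ?E = "route ?g (Node [])"
  interpret finite_sink_graph ?g using assms(1) by (rule finite_sink_graph_wired_cover)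
  note root = root_inner[OF assms(1), of G \<chi> i]
  show R: "root_order G \<chi> h i = R"
    unfolding root_order_def Let_def
    using assms(2) cyc by (intro ord_rr_element[OF root]) (auto simp: root_cycle_def)
  have "?E ` recurrent_configs ?g \<subseteq> recurrent_configs ?g"
    by (rule image_subsetI) (rule route_recurrent[OF root])
  from funpow_in[OF this assms(2)]
  have rec: "(?E ^^ n) \<rho> \<in> recurrent_configs ?g" for n .
  have shift: "?E ((?E ^^ n) \<rho>) = (?E ^^ n) (?E \<rho>)" for n by (simp add: funpow_swap1)
  have up: "(case last_edge ?g (Node []) ((?E ^^ n) \<rho>) of (v, k) \<Rightarrow> cover_nbr v k \<in> sink_up G \<chi> h i)
      \<longleftrightarrow> (?E ^^ n) (?E \<rho>) (Node []) \<noteq> 0"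
    and down: "(case last_edge ?g (Node []) ((?E ^^ n) \<rho>) of (v, k) \<Rightarrow> cover_nbr v k \<in> sink_down)
      \<longleftrightarrow> (?E ^^ n) (?E \<rho>) (Node []) = 0" for n
    using last_edge_wired_cover(2,3)[OF assms(1) rec[of n]] unfolding shift by (auto split: prod.splits)
  have "?E \<rho> \<in> recurrent_configs ?g" using rec[of 1] by simp
  then have U: "card {N. N < R \<and> (?E ^^ N) (?E \<rho>) (Node []) \<noteq> 0} = U"
    using cyc by (simp add: root_cycle_def)
  then show "stopped_up G \<chi> h i \<rho> = U"
    unfolding stopped_up_def stopped_in_def Let_def up R .
  have "stopped_down G \<chi> h i \<rho> = card {N. N < R \<and> (?E ^^ N) (?E \<rho>) (Node []) = 0}"
    unfolding stopped_down_def stopped_in_def Let_def down R ..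
  moreover have split: "card {N. N < R \<and> Q N} + card {N. N < R \<and> \<not> Q N} = R" for Q
  proof -
    have "{N. N < R \<and> Q N} \<union> {N. N < R \<and> \<not> Q N} = {..<R}" by auto
    moreover have "card ({N. N < R \<and> Q N} \<union> {N. N < R \<and> \<not> Q N}) =
        card {N. N < R \<and> Q N} + card {N. N < R \<and> \<not> Q N}"
      by (rule card_Un_disjoint) auto
    ultimately show ?thesis by simp
  qed
  ultimately show "stopped_down G \<chi> h i \<rho> + U = R"
    using U split[of "\<lambda>N. (?E ^^ N) (?E \<rho>) (Node []) = 0"] by simp
qed

lemma sum_over_children:
  fixes f :: "'a \<Rightarrow> real"
  assumes "generation_function G \<chi>" "i \<in> verts G" "finite (verts G)"
  shows "(\<Sum>k\<in>{1..outdeg G i}. f (\<chi> i k)) = (\<Sum>j\<in>verts G. real (adj G i j) * f j)"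
proof -
  have "(\<Sum>k\<in>{1..outdeg G i}. f (\<chi> i k)) = (\<Sum>j\<in>verts G. \<Sum>k\<in>{k\<in>{1..outdeg G i}. \<chi> i k = j}. f (\<chi> i k))"
    using assms by (intro sum.group[symmetric]) (auto simp: generation_function_def)
  also have "\<dots> = (\<Sum>j\<in>verts G. real (adj G i j) * f j)"
  proof (rule sum.cong)
    fix j assume "j \<in> verts G"
    then have "card {k\<in>{1..outdeg G i}. \<chi> i k = j} = adj G i j"
      using assms by (auto simp: generation_function_def)
    then show "(\<Sum>k\<in>{k\<in>{1..outdeg G i}. \<chi> i k = j}. f (\<chi> i k)) = real (adj G i j) * f j"
      by simp
  qed simp
  finally show ?thesis .
qed

theorem theorem3p9:
  fixes G :: "(nat, 'e) pre_digraph"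
    and m :: nat
    and \<chi> :: "nat \<Rightarrow> nat \<Rightarrow> nat"
    and \<rho> :: "nat \<Rightarrow> nat \<Rightarrow> cover_vertex \<Rightarrow> nat"
  assumes "fin_digraph G"
    and "verts G = {1..m}"
    and "strongly_connected G"
    and "generation_function G \<chi>"
    and "\<And>h i. i \<in> verts G \<Longrightarrow> h \<ge> 1 \<Longrightarrow> \<rho> h i \<in> recurrent_configs (wired_cover G \<chi> h i)"
  shows "(\<forall>i\<in>verts G. \<forall>h\<ge>1.
           root_order G \<chi> h i = stopped_down G \<chi> h i (\<rho> h i) + stopped_up G \<chi> h i (\<rho> h i)) \<and>
         (\<forall>i\<in>verts G. stopped_down G \<chi> 1 i (\<rho> 1 i) = 1 \<and> stopped_up G \<chi> 1 i (\<rho> 1 i) = outdeg G i) \<and>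
         (\<forall>i\<in>verts G. \<forall>h\<ge>2.
           stopped_down G \<chi> h i (\<rho> h i) =
             Lcm {root_order G \<chi> (h - 1) (\<chi> i k) | k. k \<in> {1..outdeg G i}} \<and>
           real (stopped_up G \<chi> h i (\<rho> h i)) =
             real (stopped_down G \<chi> h i (\<rho> h i)) *
             (\<Sum>j\<in>verts G. real (adj G i j) *
                (real (stopped_up G \<chi> (h - 1) j (\<rho> (h - 1) j)) / real (root_order G \<chi> (h - 1) j))))"
proof (intro conjI ballI allI impI)
  fix i h :: nat assume i: "i \<in> verts G" and h: "h \<ge> 1"
  obtain R U where "root_cycle G \<chi> h i R U" using root_cycle_exists[of h G \<chi> i] h by auto
  then show "root_order G \<chi> h i = stopped_down G \<chi> h i (\<rho> h i) + stopped_up G \<chi> h i (\<rho> h i)"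
    using root_cycle_counts[OF _ assms(5)[OF i h]] h by simp
next
  fix i assume i: "i \<in> verts G"
  note c = root_cycle_counts[OF _ assms(5)[OF i order.refl] root_cycle_height_1]
  show "stopped_up G \<chi> 1 i (\<rho> 1 i) = outdeg G i" "stopped_down G \<chi> 1 i (\<rho> 1 i) = 1"
    using c by simp_all
next
  fix i h' :: nat assume i: "i \<in> verts G" and "h' \<ge> 2"
  then obtain h where h: "h' = Suc h" "0 < h" by (cases h') auto
  define R where "R j = root_order G \<chi> h j" for j
  define U where "U j = stopped_up G \<chi> h j (\<rho> h j)" for j
  have cyc: "root_cycle G \<chi> h j (R j) (U j)" if "j \<in> verts G" for j
  proof -
    obtain R' U' where *: "root_cycle G \<chi> h j R' U'" using root_cycle_exists[OF h(2), of G \<chi> j] by blast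
    then show ?thesis
      using root_cycle_counts[OF h(2) assms(5)[OF that] *] h(2) unfolding R_def U_def by simp
  qed
  have child: "\<chi> i k \<in> verts G" if "k \<in> {1..outdeg G i}" for k
    using assms(4) i that unfolding generation_function_def by blast
  define L where "L = Lcm ((\<lambda>k. R (\<chi> i k)) ` {1..outdeg G i})"
  define V where "V = (\<Sum>k\<in>{1..outdeg G i}. L div R (\<chi> i k) * U (\<chi> i k))"
  have "root_cycle G \<chi> (Suc h) i (L + V) V"
    unfolding V_def L_def using cyc child by (intro root_cycle_Suc[OF h(2)]) auto
  from root_cycle_counts[OF _ assms(5)[OF i] this]
  have L: "stopped_down G \<chi> h' i (\<rho> h' i) = L" and V: "stopped_up G \<chi> h' i (\<rho> h' i) = V"
    using h by simp_all
  show "stopped_down G \<chi> h' i (\<rho> h' i) = Lcm {root_order G \<chi> (h' - 1) (\<chi> i k) | k. k \<in> {1..outdeg G i}}"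
    unfolding L unfolding L_def R_def h by (rule arg_cong[where f = Lcm]) auto
  have "real V = (\<Sum>k\<in>{1..outdeg G i}. real L * (real (U (\<chi> i k)) / real (R (\<chi> i k))))"
    unfolding V_def of_nat_sum
  proof (rule sum.cong)
    fix k assume "k \<in> {1..outdeg G i}"
    then have "R (\<chi> i k) dvd L" unfolding L_def by simp
    then show "real (L div R (\<chi> i k) * U (\<chi> i k)) = real L * (real (U (\<chi> i k)) / real (R (\<chi> i k)))"
      by (simp add: real_of_nat_div)
  qed simp
  also have "\<dots> = real L * (\<Sum>k\<in>{1..outdeg G i}. real (U (\<chi> i k)) / real (R (\<chi> i k)))"
    by (simp only: sum_distrib_left)
  also have "\<dots> = real L * (\<Sum>j\<in>verts G. real (adj G i j) * (real (U j) / real (R j)))"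
    using sum_over_children[OF assms(4) i, of "\<lambda>j. real (U j) / real (R j)"] assms(2) by simp
  finally show "real (stopped_up G \<chi> h' i (\<rho> h' i)) = real (stopped_down G \<chi> h' i (\<rho> h' i)) *
      (\<Sum>j\<in>verts G. real (adj G i j) *
        (real (stopped_up G \<chi> (h' - 1) j (\<rho> (h' - 1) j)) / real (root_order G \<chi> (h' - 1) j)))"
    unfolding L V unfolding U_def R_def h by simp
qed

end
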